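(* Let $X$ and $Y$ be two compact metric spaces, and let $T^-$ be a map assigning to each $g\in C(Y)$ a function $T^-g:X\to[-\infty,+\infty)$. The following assertions are equivalent: (1) $T^-$ is a backward Kantorovich operator from $C(Y)$ to $USC(X)$. (2) There exists a backward linear transfer $\mathcal{T}:\mathcal{P}(X)\times\mathcal{P}(Y)\to\mathbb{R}\cup\{+\infty\}$ such that for all $\mu\in\mathcal{P}(X)$ and $g\in C(Y)$, $$\mathcal{T}_\mu^*(g)=\int_XT^-g\,d\mu .$$ (3) There exists a proper lower semi-continuous function $c:X\times\mathcal{P}(Y)\to\mathbb{R}\cup\{+\infty\}$ such that for all $x\in X$ the functional $\sigma\mapsto c(x,\sigma)$ is convex, and for any $g\in C(Y)$ and $x\in X$, $$T^-g(x)=\sup\Big\{\int_Yg\,d\sigma-c(x,\sigma):\ \sigma\in\mathcal{P}(Y)\Big\}.$$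
   Context: $\mathcal{M}$: signed Radon measures; $\mathcal{P}$: probability measures, with the weak$^*$ topology. $USC(X)$: bounded above, proper (not identically $-\infty$), upper semi-continuous functions $X\to[-\infty,\infty)$. Backward Kantorovich operator: a map $T^-:C(Y)\to USC(X)$ that is (i) monotone: $g_1\le g_2\Rightarrow T^-g_1\le T^-g_2$; (ii) affine on constants: $T^-(g+c)=T^-g+c$ for $c\in\mathbb{R}$; (iii) convex: $T^-(\lambda g_1+(1-\lambda)g_2)\le\lambda T^-g_1+(1-\lambda)T^-g_2$ for $\lambda\in[0,1]$; (iv) lower semi-continuous: $g_n\to g$ in sup norm implies $\liminf_nT^-g_n\ge T^-g$ pointwise. Backward linear transfer: a functional $\mathcal{T}:\mathcal{M}(X)\times\mathcal{M}(Y)\to\mathbb{R}\cup\{+\infty\}$ that is proper, convex, bounded below and weak$^*$ lower semi-continuous, with $\{\mathcal{T}<+\infty\}\subset\mathcal{P}(X)\times\mathcal{P}(Y)$, and for which there is a map $S$ from $C(Y)$ into the bounded above Borel functions on $X$ with $\mathcal{T}_\mu^*(g)=\int_XSg\,d\mu$ for all $\mu\in\mathcal{P}(X)$ and $g\in C(Y)$, where $\mathcal{T}_\mu^*(g):=\sup_{\sigma\in\mathcal{P}(Y)}\{\int_Yg\,d\sigma-\mathcal{T}(\mu,\sigma)\}$. A functional on $\mathcal{P}(X)\times\mathcal{P}(Y)$ is identified with its extension by $+\infty$. In (2) it is understood that each $T^-g$ is a bounded above Borel function. *)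

theory Defs
  imports "HOL-Analysis.Analysis" "HOL-Probability.Probability_Measure"
begin

subsection \<open>Signed measures and the weak* topology\<close>

text \<open>
  Real-valued countably additive functions on the Borel sets, set to zero on all other sets. On a
  compact metric space every such function is automatically regular, so these are exactly the
  signed Radon measures.
\<close>

typedef (overloaded) 'a::topological_space signed_measure =
  "{\<nu> :: 'a set \<Rightarrow> real.
      (\<forall>A. A \<notin> sets borel \<longrightarrow> \<nu> A = 0) \<and>
      (\<forall>A. range A \<subseteq> sets borel \<longrightarrow> disjoint_family A \<longrightarrow>
         (\<lambda>i::nat. \<nu> (A i)) sums \<nu> (\<Union>i. A i))}"
  morphisms smeasure Abs_signed_measure
  by (rule exI[of _ "\<lambda>_. 0"]) simp

setup_lifting type_definition_signed_measure

instantiation signed_measure :: (topological_space) real_vector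
begin

lift_definition zero_signed_measure :: "'a signed_measure" is "\<lambda>_. 0" by simp

lift_definition plus_signed_measure ::
  "'a signed_measure \<Rightarrow> 'a signed_measure \<Rightarrow> 'a signed_measure" is "\<lambda>\<mu> \<nu> A. \<mu> A + \<nu> A"
  by (auto intro: sums_add)

lift_definition minus_signed_measure ::
  "'a signed_measure \<Rightarrow> 'a signed_measure \<Rightarrow> 'a signed_measure" is "\<lambda>\<mu> \<nu> A. \<mu> A - \<nu> A"
  by (auto intro: sums_diff)

lift_definition uminus_signed_measure ::
  "'a signed_measure \<Rightarrow> 'a signed_measure" is "\<lambda>\<nu> A. - \<nu> A"
  by (auto intro: sums_minus)

lift_definition scaleR_signed_measure ::
  "real \<Rightarrow> 'a signed_measure \<Rightarrow> 'a signed_measure" is "\<lambda>r \<nu> A. r * \<nu> A"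
  by (auto intro: sums_mult)

instance
  by standard (transfer, auto simp: algebra_simps)+

end

text \<open>Jordan decomposition: \<open>\<nu>\<^sup>+(A) = sup {\<nu>(B) | B \<subseteq> A Borel}\<close> and \<open>\<nu>\<^sup>- = (-\<nu>)\<^sup>+\<close>.
  Truncation by \<^const>\<open>ennreal\<close> is harmless since \<open>B = {}\<close> is admitted.\<close>

definition pos_part_measure :: "'a::topological_space signed_measure \<Rightarrow> 'a measure" where
  "pos_part_measure \<nu> =
     measure_of UNIV (sets borel) (\<lambda>A. SUP B\<in>{B \<in> sets borel. B \<subseteq> A}. ennreal (smeasure \<nu> B))"

definition signed_integral :: "'a::topological_space signed_measure \<Rightarrow> ('a \<Rightarrow> real) \<Rightarrow> real" where
  "signed_integral \<nu> f =
     (\<integral>x. f x \<partial>pos_part_measure \<nu>) - (\<integral>x. f x \<partial>pos_part_measure (- \<nu>))"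

text \<open>The topology of this type is the weak* topology: the coarsest one for which
  \<open>\<nu> \<mapsto> \<integral> f d\<nu>\<close> is continuous for every bounded continuous \<open>f\<close>.\<close>

instantiation signed_measure :: (topological_space) topological_space
begin

definition open_signed_measure :: "'a signed_measure set \<Rightarrow> bool" where
  "open_signed_measure = generate_topology
     {{\<nu>. signed_integral \<nu> (apply_bcontfun f) \<in> U} | (f :: 'a \<Rightarrow>\<^sub>C real) U. open U}"

instance
  by standard (auto simp: open_signed_measure_def intro: generate_topology.intros)

end

definition prob_measures :: "'a::topological_space measure set" where
  "prob_measures = {p. prob_space p \<and> sets p = sets borel}"

definition signed_of :: "'a::topological_space measure \<Rightarrow> 'a signed_measure" where
  "signed_of p = Abs_signed_measure (measure p)"

lemma smeasure_signed_of:
  assumes "finite_measure p" "sets p = sets borel"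
  shows "smeasure (signed_of p) = measure p"
  unfolding signed_of_def
  using assms finite_measure.finite_measure_UNION[OF assms(1)]
  by (subst Abs_signed_measure_inverse) (auto simp: measure_notin_sets)

lemma signed_integral_signed_of:
  assumes "finite_measure p" "sets p = sets borel"
  shows "signed_integral (signed_of p) f = (\<integral>x. f x \<partial>p)"
proof -
  interpret finite_measure p by fact
  have sp: "space p = UNIV" using assms(2) by (metis sets_eq_imp_space_eq space_borel)
  have pos: "(SUP B\<in>{B \<in> sets borel. B \<subseteq> A}. ennreal (smeasure (signed_of p) B)) = emeasure p A"
    if "A \<in> sets borel" for A
    unfolding smeasure_signed_of[OF assms] emeasure_eq_measure[symmetric]
    using that assms(2) by (intro antisym SUP_least SUP_upper) (auto intro: emeasure_mono)
  have "pos_part_measure (signed_of p) = measure_of UNIV (sets borel) (emeasure p)"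
    unfolding pos_part_measure_def by (rule measure_of_eq) (auto simp: pos sets.sigma_sets_eq[of borel, simplified])
  also have "\<dots> = p"
    using measure_of_of_measure[of p] sp assms(2) by simp
  finally have 1: "pos_part_measure (signed_of p) = p" .
  have "smeasure (- signed_of p) B = - measure p B" for B
    using smeasure_signed_of[OF assms] by (simp add: uminus_signed_measure.rep_eq)
  then have neg: "(SUP B\<in>{B \<in> sets borel. B \<subseteq> A}. ennreal (smeasure (- signed_of p) B)) = 0" for A
    by (intro antisym SUP_least) (auto simp: ennreal_neg)
  have "pos_part_measure (- signed_of p) = measure_of UNIV (sets borel) (\<lambda>_. 0)"
    unfolding pos_part_measure_def neg ..
  also have "\<dots> = null_measure borel"
    unfolding null_measure_def by simp
  finally have 2: "pos_part_measure (- signed_of p) = null_measure borel" .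
  show ?thesis unfolding signed_integral_def 1 2 by simp
qed


subsection \<open>Semicontinuity and the integral of functions bounded above\<close>

definition lsc_on :: "'a::topological_space set \<Rightarrow> ('a \<Rightarrow> ereal) \<Rightarrow> bool" where
  "lsc_on S f \<longleftrightarrow> (\<forall>a. closedin (top_of_set S) {x \<in> S. f x \<le> a})"

definition usc :: "('a::topological_space \<Rightarrow> ereal) \<Rightarrow> bool" where
  "usc f \<longleftrightarrow> (\<forall>a. closed {x. a \<le> f x})"

definition bounded_above :: "('a \<Rightarrow> ereal) \<Rightarrow> bool" where
  "bounded_above f \<longleftrightarrow> (\<exists>C::real. \<forall>x. f x \<le> ereal C)"

definition USC :: "('a::topological_space \<Rightarrow> ereal) set" where
  "USC = {f. bounded_above f \<and> (\<exists>x. f x \<noteq> - \<infinity>) \<and> usc f}"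

definition bounded_above_borel :: "('a::topological_space \<Rightarrow> ereal) set" where
  "bounded_above_borel = {f. bounded_above f \<and> f \<in> borel_measurable borel}"

text \<open>\<open>\<integral> f\<^sup>+ d\<mu> - \<integral> f\<^sup>- d\<mu>\<close>, with value \<open>-\<infinity>\<close> allowed; for \<open>f\<close> bounded above and \<open>\<mu>\<close> finite the
  first term is finite. Note that \<^const>\<open>e2ennreal\<close> truncates at zero.\<close>

definition ereal_integral :: "'a measure \<Rightarrow> ('a \<Rightarrow> ereal) \<Rightarrow> ereal" where
  "ereal_integral \<mu> f =
     enn2ereal (\<integral>\<^sup>+x. e2ennreal (f x) \<partial>\<mu>) - enn2ereal (\<integral>\<^sup>+x. e2ennreal (- f x) \<partial>\<mu>)"


subsection \<open>Kantorovich operators and linear transfers\<close>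

definition backward_Kantorovich_operator ::
  "(('b::topological_space \<Rightarrow>\<^sub>C real) \<Rightarrow> 'a::topological_space \<Rightarrow> ereal) \<Rightarrow> bool" where
  "backward_Kantorovich_operator T \<longleftrightarrow>
     (\<forall>g. T g \<in> USC) \<and>
     (\<forall>g1 g2. (\<forall>y. apply_bcontfun g1 y \<le> apply_bcontfun g2 y) \<longrightarrow> (\<forall>x. T g1 x \<le> T g2 x)) \<and>
     (\<forall>g c x. T (g + const_bcontfun c) x = T g x + ereal c) \<and>
     (\<forall>g1 g2 t x. 0 \<le> t \<and> t \<le> 1 \<longrightarrow>
        T (t *\<^sub>R g1 + (1 - t) *\<^sub>R g2) x \<le> ereal t * T g1 x + ereal (1 - t) * T g2 x) \<and>
     (\<forall>gs g x. gs \<longlonglongrightarrow> g \<longrightarrow> T g x \<le> liminf (\<lambda>n. T (gs n) x))"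

definition transfer_conj ::
  "('a::topological_space signed_measure \<times> 'b::topological_space signed_measure \<Rightarrow> ereal) \<Rightarrow>
   'a measure \<Rightarrow> ('b \<Rightarrow>\<^sub>C real) \<Rightarrow> ereal" where
  "transfer_conj \<T> \<mu> g =
     (SUP \<sigma>\<in>prob_measures. ereal (\<integral>y. apply_bcontfun g y \<partial>\<sigma>) - \<T> (signed_of \<mu>, signed_of \<sigma>))"

definition backward_linear_transfer ::
  "('a::topological_space signed_measure \<times> 'b::topological_space signed_measure \<Rightarrow> ereal) \<Rightarrow> bool"
  where
  "backward_linear_transfer \<T> \<longleftrightarrow>
     (\<forall>p. \<T> p \<noteq> - \<infinity>) \<and> (\<exists>p. \<T> p \<noteq> \<infinity>) \<and>
     (\<forall>p q t. 0 \<le> t \<and> t \<le> 1 \<longrightarrow>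
        \<T> (t *\<^sub>R p + (1 - t) *\<^sub>R q) \<le> ereal t * \<T> p + ereal (1 - t) * \<T> q) \<and>
     (\<exists>m::real. \<forall>p. ereal m \<le> \<T> p) \<and>
     lsc_on UNIV \<T> \<and>
     {p. \<T> p < \<infinity>} \<subseteq> (signed_of ` prob_measures) \<times> (signed_of ` prob_measures) \<and>
     (\<exists>S :: ('b \<Rightarrow>\<^sub>C real) \<Rightarrow> 'a \<Rightarrow> ereal.
        (\<forall>g. S g \<in> bounded_above_borel) \<and>
        (\<forall>\<mu>\<in>prob_measures. \<forall>g. transfer_conj \<T> \<mu> g = ereal_integral \<mu> (S g)))"

end

theory Submission
  imports Defs "HOL-Probability.Probability_Mass_Function"
begin

text \<open>
  For a Kantorovich operator \<open>T\<close> and a probability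
  measure \<open>\<mu>\<close>, the functional \<open>p(g) = \<integral> T g d\<mu>\<close> on \<open>C(Y)\<close> is convex, monotone and affine on
  constants. By Hahn-Banach it has a subgradient at every point; monotonicity makes the subgradient
  positive and affinity on constants gives it mass 1, so by Riesz it is integration against a
  probability measure. Hence \<open>p\<close> is recovered from its Legendre dual
  \<open>\<T>(\<mu>, \<sigma>) = sup\<^sub>g \<integral> g d\<sigma> - \<integral> T g d\<mu>\<close>, without any measurable selection. Lower semicontinuity
  of \<open>\<T>\<close> holds because an upper semicontinuous \<open>T g\<close> is a decreasing limit of continuous functions
  and the probability measures are weak* closed among the signed measures. Restricting \<open>\<T>\<close> to Dirac
  masses in the first variable yields \<open>c\<close>, and weak* compactness of the probability measures turns
  lower semicontinuity of \<open>c\<close> back into upper semicontinuity of \<open>T g\<close>.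
\<close>

subsection \<open>Riesz representation on compact metric spaces\<close>

text \<open>The value -infinity is the recurring obstacle: \<open>T g\<close> may take it, and so
  may its integral. Two devices contain it. Monotonicity and affinity on constants give p(g) <= p(h)
  + norm (g - h), so p is either real everywhere or identically -infinity, and only the real case
  needs a subgradient. Integrals of functions bounded by C are rewritten as C minus the integral of
  C - f, a nonnegative integrand for which monotone convergence and additivity hold without
  exception. The linear minorant may be found purely algebraically: its continuity is never asked
  for, because the Riesz representation here uses only positivity and mass 1. A transfer lives on
  all pairs of signed measures, so its sublevel sets have to be closed there and not merely among
  probability measures. Riesz representation is therefore used a second time: positivity and
  normalization of the integrals against continuous functions are closed conditions, and a signed
  measure satisfying them is a probability measure. The same set of functionals, viewed in a product
  of intervals, supplies the compactness.\<close>

locale mean_functional =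
  fixes L :: "('a::metric_space \<Rightarrow> real) \<Rightarrow> real"
  assumes compact_space: "compact (UNIV :: 'a set)"
    and add: "continuous_on UNIV f \<Longrightarrow> continuous_on UNIV g \<Longrightarrow> L (\<lambda>x. f x + g x) = L f + L g"
    and scale: "continuous_on UNIV f \<Longrightarrow> L (\<lambda>x. c * f x) = c * L f"
    and mono: "continuous_on UNIV f \<Longrightarrow> continuous_on UNIV g \<Longrightarrow> (\<And>x. f x \<le> g x) \<Longrightarrow> L f \<le> L g"
    and const: "L (\<lambda>_. c) = c"
begin

section \<open>Content of open sets and the induced outer measure\<close>

text \<open>Domination by the indicator replaces the usual requirement of support inside
  \<open>U\<close>: a member vanishes outside \<open>U\<close> but may be positive arbitrarily close
  to its boundary. \<open>content_split\<close> compensates by a truncation.\<close>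

definition subordinate :: "'a set \<Rightarrow> ('a \<Rightarrow> real) set" where
  "subordinate U = {f. continuous_on UNIV f \<and> (\<forall>x. 0 \<le> f x \<and> f x \<le> indicator U x)}"

definition content :: "'a set \<Rightarrow> ennreal" where
  "content U = (SUP f\<in>subordinate U. ennreal (L f))"

definition outer :: "'a set \<Rightarrow> ennreal" where
  "outer A = (INF U\<in>{U. open U \<and> A \<subseteq> U}. content U)"

lemma subordinate_mono: "U \<subseteq> V \<Longrightarrow> subordinate U \<subseteq> subordinate V"
  unfolding subordinate_def by (auto simp: indicator_def) (metis order.trans zero_le_one)+

lemma subordinateI:
  "continuous_on UNIV f \<Longrightarrow> (\<And>x. 0 \<le> f x) \<Longrightarrow> (\<And>x. f x \<le> indicator U x) \<Longrightarrow> f \<in> subordinate U"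
  by (simp add: subordinate_def)

lemma subordinateD:
  assumes "f \<in> subordinate U"
  shows "continuous_on UNIV f" "0 \<le> f x" "f x \<le> indicator U x"
  using assms by (auto simp: subordinate_def)

lemma zero_subordinate: "(\<lambda>_. 0) \<in> subordinate U"
  by (simp add: subordinate_def)

lemma content_mono: "U \<subseteq> V \<Longrightarrow> content U \<le> content V"
  unfolding content_def by (intro SUP_subset_mono subordinate_mono) auto

lemma L_nonneg: "f \<in> subordinate U \<Longrightarrow> 0 \<le> L f"
  using mono[of "\<lambda>_. 0" f] const[of 0] by (auto simp: subordinate_def)

lemma le_content: "f \<in> subordinate U \<Longrightarrow> ennreal (L f) \<le> content U"
  unfolding content_def by (rule SUP_upper)

lemma outer_open: "open U \<Longrightarrow> outer U = content U"
  unfolding outer_def by (intro antisym INF_lower INF_greatest content_mono) auto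

lemma outer_le: "open U \<Longrightarrow> A \<subseteq> U \<Longrightarrow> outer A \<le> content U"
  unfolding outer_def by (intro INF_lower) auto

lemma outer_mono: "A \<subseteq> B \<Longrightarrow> outer A \<le> outer B"
  unfolding outer_def by (intro INF_superset_mono) auto

lemma content_empty: "content {} = 0"
proof -
  have "subordinate {} = {\<lambda>_. 0}"
    by (auto simp: subordinate_def fun_eq_iff intro: antisym)
  then show ?thesis by (simp add: content_def const)
qed

lemma content_UNIV: "content UNIV = 1"
proof (rule antisym)
  have "L f \<le> 1" if "f \<in> subordinate UNIV" for f
    using that mono[of f "\<lambda>_. 1"] const[of 1] by (auto simp: subordinate_def)
  then show "content UNIV \<le> 1"
    unfolding content_def by (intro SUP_least) simp
  show "1 \<le> content UNIV"
    using le_content[of "\<lambda>_. 1" UNIV] const[of 1] by (simp add: subordinate_def)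
qed

lemma open_approx:
  assumes "open U"
  shows "\<exists>h :: nat \<Rightarrow> 'a \<Rightarrow> real. (\<forall>n. h n \<in> subordinate U) \<and>
    (\<forall>m n x. m \<le> n \<longrightarrow> h m x \<le> h n x) \<and> (\<forall>x\<in>U. \<exists>n. h n x = 1)"
\<comment> \<open>\<open>infdist\<close> to the empty set is 0 by convention, so the distance
  formula below would give the zero function when \<open>- U\<close> is empty.\<close>
proof (cases "U = UNIV")
  case True
  show ?thesis
    by (rule exI[of _ "\<lambda>_ _. 1"]) (auto simp: True subordinate_def)
next
  case False
  define h where "h n x = min 1 (real n * infdist x (- U))" for n x
  have "continuous_on UNIV (h n)" for n
    unfolding h_def by (intro continuous_intros)
  moreover have "h n x \<le> indicator U x" for n x
    by (auto simp: h_def indicator_def)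
  ultimately have "h n \<in> subordinate U" for n
    by (auto simp: subordinate_def h_def infdist_nonneg)
  moreover have "h m x \<le> h n x" if "m \<le> n" for m n x
    using that unfolding h_def by (intro min.mono mult_right_mono) (auto simp: infdist_nonneg)
  moreover have "\<exists>n. h n x = 1" if "x \<in> U" for x
  proof -
    have "infdist x (- U) > 0"
      using infdist_pos_not_in_closed[of "- U" x] assms False that by auto
    moreover obtain n where "real n \<ge> 1 / infdist x (- U)"
      using real_arch_simple by blast
    ultimately have "h n x = 1" unfolding h_def by (simp add: field_simps min_def)
    then show ?thesis ..
  qed
  ultimately show ?thesis by blast
qed

lemma L_sum: "finite I \<Longrightarrow> (\<And>i. i \<in> I \<Longrightarrow> continuous_on UNIV (f i)) \<Longrightarrow>
   L (\<lambda>x. \<Sum>i\<in>I. f i x) = (\<Sum>i\<in>I. L (f i))"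
  by (induction I rule: finite_induct) (auto simp: const add continuous_on_sum)

text \<open>Dini's theorem is built in: the sets where \<open>f\<close> exceeds the \<open>n\<close>-th partial sum of the
  approximants by less than \<open>e\<close> form an increasing open cover.\<close>

lemma content_UN:
  assumes U: "\<And>i. open (U i)"
  shows "content (\<Union>i. U i) \<le> (\<Sum>i::nat. content (U i))"
  unfolding content_def[of "\<Union>i. U i"]
proof (rule SUP_least, rule ennreal_le_epsilon)
  fix f and e :: real assume f: "f \<in> subordinate (\<Union>i. U i)" and e: "0 < e"
  obtain h where h: "\<And>i n::nat. h i n \<in> subordinate (U i)"
    "\<And>i m n x. m \<le> n \<Longrightarrow> h i m x \<le> h i n x" "\<And>i x. x \<in> U i \<Longrightarrow> \<exists>n. h i n x = 1"
    using open_approx[OF U] by metis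
  have hc: "continuous_on UNIV (h i n)" and h0: "0 \<le> h i n x" for i n x
    using h(1)[of i n] by (auto simp: subordinate_def)
  have fc: "continuous_on UNIV f" and f1: "f x \<le> indicator (\<Union>i. U i) x" for x
    using f by (auto simp: subordinate_def)
  define V where "V n = {x. f x < (\<Sum>i<n. h i n x) + e}" for n
  have Vo: "open (V n)" for n
    unfolding V_def by (intro open_Collect_less continuous_intros fc hc)
  have Vmono: "V m \<subseteq> V n" if "m \<le> n" for m n
  proof -
    have "(\<Sum>i<m. h i m x) \<le> (\<Sum>i<n. h i n x)" for x
      by (rule order_trans[OF sum_mono sum_mono2]) (use that h(2) h0 in auto)
    then show ?thesis unfolding V_def by (auto intro: less_le_trans)
  qed
  have "x \<in> (\<Union>n. V n)" for x
  proof (cases "x \<in> (\<Union>i. U i)")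
    case True
    then obtain i n where n: "h i n x = 1" using h(3) by blast
    \<comment> \<open>In \<open>V\<close> one index bounds both the number of sets and the order of
      the approximants: it must exceed \<open>i\<close> for the \<open>i\<close>-th summand to
      occur, and reach \<open>n\<close> for that summand to equal 1.\<close>
    let ?N = "max (Suc i) n"
    have "1 \<le> h i ?N x" using n h(2)[of n ?N i x] by simp
    also have "\<dots> \<le> (\<Sum>i<?N. h i ?N x)"
      using h0 by (intro member_le_sum) auto
    finally have "x \<in> V ?N" using f1[of x] e True by (simp add: V_def)
    then show ?thesis by blast
  next
    case False
    then have "x \<in> V 0" using f1[of x] e by (simp add: V_def)
    then show ?thesis by blast
  qed
  then have cover: "UNIV \<subseteq> (\<Union>n\<in>UNIV. V n)" by blast
  obtain I where I: "finite I" "UNIV \<subseteq> (\<Union>n\<in>I. V n)"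
    by (rule compactE_image[OF compact_space Vo cover])
  define n where "n = Max (insert 0 I)"
  have le: "f x \<le> (\<Sum>i<n. h i n x) + e" for x
  proof -
    obtain k where k: "k \<in> I" "x \<in> V k" using I(2) by blast
    then have "k \<le> n" using I(1) by (simp add: n_def)
    then show ?thesis using Vmono[of k n] k by (auto simp: V_def)
  qed
  have "L f \<le> L (\<lambda>x. (\<Sum>i<n. h i n x) + e)"
    by (intro mono fc continuous_intros hc le)
  also have "\<dots> = (\<Sum>i<n. L (h i n)) + e"
    by (subst add) (auto simp: const L_sum hc intro!: continuous_intros)
  finally have "ennreal (L f) \<le> (\<Sum>i<n. ennreal (L (h i n))) + ennreal e"
    using L_nonneg[OF h(1)] e by (simp add: sum_nonneg flip: ennreal_plus)
  also have "\<dots> \<le> (\<Sum>i<n. content (U i)) + ennreal e"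
    by (intro add_mono sum_mono le_content h(1)) simp
  also have "\<dots> \<le> (\<Sum>i. content (U i)) + ennreal e"
    by (intro add_mono sum_le_suminf) auto
  finally show "ennreal (L f) \<le> (\<Sum>i. content (U i)) + ennreal e" .
qed

lemma outer_measure_space_outer: "outer_measure_space UNIV outer"
  unfolding outer_measure_space_def
proof (intro conjI)
  show "positive UNIV outer"
    using outer_open[of "{}"] by (simp add: positive_def content_empty)
  show "increasing UNIV outer"
    by (simp add: increasing_def outer_mono)
  show "countably_subadditive UNIV outer"
    unfolding countably_subadditive_def
  proof (intro allI impI, rule ennreal_le_epsilon)
    fix A :: "nat \<Rightarrow> 'a set" and e :: real
    assume e: "0 < e" and fin: "(\<Sum>i. outer (A i)) < top"
    \<comment> \<open>Finiteness of the whole sum makes each \<open>outer (A n)\<close> finite, so a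
      positive increment is strict and the infimum defining \<open>outer\<close> yields an open
      superset. The increments add up to \<open>e\<close>.\<close>
    have *: "outer (A n) < outer (A n) + ennreal (e * (1/2)^Suc n)" for n
      using ennreal_suminf_lessD[OF fin, of n] e by (cases "outer (A n)") (auto simp flip: ennreal_plus intro!: ennreal_lessI add_nonneg_pos mult_pos_pos)
    have "\<exists>U. open U \<and> A n \<subseteq> U \<and> content U \<le> outer (A n) + ennreal (e * (1/2)^Suc n)" for n
      using *[of n] unfolding outer_def[of "A n"] INF_less_iff by (auto intro: less_imp_le)
    then obtain U where U: "\<And>n. open (U n)" "\<And>n. A n \<subseteq> U n"
      "\<And>n. content (U n) \<le> outer (A n) + ennreal (e * (1/2)^Suc n)" by metis
    have "outer (\<Union>i. A i) \<le> content (\<Union>i. U i)"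
      using U by (intro outer_le) auto
    also have "\<dots> \<le> (\<Sum>i. content (U i))" by (rule content_UN[OF U(1)])
    also have "\<dots> \<le> (\<Sum>n. outer (A n) + ennreal (e * (1/2) ^ Suc n))"
      by (intro suminf_le allI U) auto
    also have "... = (\<Sum>n. outer (A n)) + (\<Sum>n. ennreal e * ennreal ((1/2) ^ Suc n))"
      using e by (subst suminf_add[symmetric])
        (auto simp del: ennreal_suminf_cmult simp add: ennreal_mult[symmetric])
    also have "\<dots> = (\<Sum>n. outer (A n)) + e"
      unfolding ennreal_suminf_cmult
      by (subst suminf_ennreal_eq[OF zero_le_power power_half_series]) auto
    finally show "outer (\<Union>i. A i) \<le> (\<Sum>i. outer (A i)) + ennreal e" .
  qed
qed

lemma outer_subadditive: "outer (A \<union> B) \<le> outer A + outer B"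
proof -
  have "subadditive UNIV outer"
    using outer_measure_space_outer ring_of_sets.countably_subadditive_subadditive[of UNIV UNIV outer]
    by (simp add: outer_measure_space_def ring_of_sets_Pow[of UNIV, simplified])
  then have "outer (A \<union> (B - A)) \<le> outer A + outer (B - A)"
    by (intro subadditiveD) auto
  also have "\<dots> \<le> outer A + outer B"
    by (intro add_left_mono outer_mono) auto
  finally show ?thesis by simp
qed

text \<open>The nontrivial half of Caratheodory's criterion, for open test sets. A function
  \<open>f\<close> subordinate to \<open>U \<inter> V\<close> cannot simply be added to one
  concentrated near \<open>V - U\<close>, since both may be positive at the same point. Lowering
  \<open>f\<close> by \<open>e\<close> and cutting at 0 costs at most \<open>e\<close> and makes it
  vanish on the open set \<open>W\<close>, which contains \<open>V - U\<close>.\<close>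

lemma content_split:
  assumes U: "open U" and V: "open V"
  shows "content (U \<inter> V) + outer (V - U) \<le> content V"
proof -
  have "ennreal (L f) + outer (V - U) \<le> content V" if f: "f \<in> subordinate (U \<inter> V)" for f
  proof (rule ennreal_le_epsilon)
    fix e :: real assume e: "0 < e"
    define W where "W = V \<inter> {x. f x < e}"
    define f' where "f' x = max (f x - e) 0" for x
    have fc: "continuous_on UNIV f" and f1: "0 \<le> f x" "f x \<le> indicator (U \<inter> V) x" for x
      using f by (auto simp: subordinate_def)
    have f'c: "continuous_on UNIV f'"
      unfolding f'_def by (intro continuous_intros fc)
    have f': "f' \<in> subordinate V"
    proof (rule subordinateI)
      fix x
      have "f \<in> subordinate V" using subordinate_mono[of "U \<inter> V" V] f by blast
      then have "f x \<le> indicator V x" by (rule subordinateD)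
      then show "f' x \<le> indicator V x" using f1(1)[of x] e by (auto simp: f'_def)
    qed (use f'c in \<open>auto simp: f'_def\<close>)
    have "open W"
      unfolding W_def by (intro open_Int V open_Collect_less fc continuous_intros)
    moreover have "V - U \<subseteq> W"
    proof
      fix x assume x: "x \<in> V - U"
      then have "f x \<le> 0" using f1(2)[of x] by simp
      then show "x \<in> W" using x e by (simp add: W_def)
    qed
    ultimately have "outer (V - U) \<le> content W" by (rule outer_le)
    then have "ennreal (L f) + outer (V - U) \<le> content W + ennreal (L f)"
      by (simp add: add.commute add_left_mono)
    also have "\<dots> = (SUP g\<in>subordinate W. ennreal (L g) + ennreal (L f))"
      unfolding content_def by (intro ennreal_SUP_add_left[symmetric]) (use zero_subordinate in blast)
    also have "\<dots> \<le> content V + ennreal e"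
    proof (rule SUP_least)
      fix g assume g: "g \<in> subordinate W"
      then have gc: "continuous_on UNIV g" and g1: "0 \<le> g x" "g x \<le> indicator W x" for x
        by (auto simp: subordinate_def)
      have "f' x + g x \<le> indicator V x" for x
      proof (cases "x \<in> W")
        case True
        then show ?thesis using g1(2)[of x] by (simp add: W_def f'_def)
      next
        case False
        then have "g x = 0" using g1[of x] by simp
        then show ?thesis using f' by (simp add: subordinate_def)
      qed
      then have fg: "(\<lambda>x. f' x + g x) \<in> subordinate V"
        using f' g1 f'c gc by (auto simp: subordinate_def intro!: continuous_intros)
      have "L f \<le> L (\<lambda>x. f' x + e)"
        by (intro mono continuous_intros f'c fc) (simp add: f'_def)
      also have "\<dots> = L f' + e"
        by (subst add) (auto simp: const f'c)
      finally have "L g + L f \<le> L (\<lambda>x. f' x + g x) + e"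
        by (simp add: add f'c gc)
      then have "ennreal (L g) + ennreal (L f) \<le> ennreal (L (\<lambda>x. f' x + g x)) + ennreal e"
        using L_nonneg[OF f] L_nonneg[OF g] L_nonneg[OF fg] e
        by (simp add: ennreal_leI flip: ennreal_plus)
      also have "\<dots> \<le> content V + ennreal e"
        by (intro add_right_mono le_content fg)
      finally show "ennreal (L g) + ennreal (L f) \<le> content V + ennreal e" .
    qed
    finally show "ennreal (L f) + outer (V - U) \<le> content V + ennreal e" .
  qed
  then show ?thesis
    unfolding content_def[of "U \<inter> V"]
    by (subst ennreal_SUP_add_left[symmetric]) (auto intro: SUP_least zero_subordinate)
qed

lemma open_in_lambda_system:
  assumes U: "open U" shows "U \<in> lambda_system UNIV UNIV outer"
  unfolding lambda_system_def
proof (clarsimp, rule antisym)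
  fix A
  show "outer A \<le> outer (U \<inter> A) + outer ((UNIV - U) \<inter> A)"
    using outer_subadditive[of "U \<inter> A" "(UNIV - U) \<inter> A"] by (simp add: Int_Un_distrib2[symmetric])
  show "outer (U \<inter> A) + outer ((UNIV - U) \<inter> A) \<le> outer A"
    unfolding outer_def[of A]
  proof (rule INF_greatest)
    fix V assume V: "V \<in> {V. open V \<and> A \<subseteq> V}"
    have "outer (U \<inter> A) + outer ((UNIV - U) \<inter> A) \<le> content (U \<inter> V) + outer (V - U)"
      using U V by (intro add_mono outer_le outer_mono) auto
    also have "\<dots> \<le> content V" using content_split U V by auto
    finally show "outer (U \<inter> A) + outer ((UNIV - U) \<inter> A) \<le> content V" .
  qed
qed

text \<open>Caratheodory's theorem: the sets that split every set additively form a sigma-algebra on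
  which \<open>outer\<close> is a measure, and it contains the open sets, hence all Borel
  sets.\<close>

lemma measure_space_outer: "measure_space UNIV (sets borel) outer"
proof -
  have ms: "measure_space UNIV (lambda_system UNIV UNIV outer) outer"
    using sigma_algebra.caratheodory_lemma[OF sigma_algebra_Pow[of UNIV, unfolded Pow_UNIV] outer_measure_space_outer] .
  then interpret sigma_algebra UNIV "lambda_system UNIV UNIV outer"
    by (simp add: measure_space_def)
  have sub: "sets borel \<subseteq> lambda_system UNIV UNIV outer"
    unfolding sets_borel using open_in_lambda_system by (intro sigma_sets_subset) auto
  show ?thesis
    using measure_down[OF ms _ sub] sets.sigma_algebra_axioms[of borel] by (metis space_borel)
qed

definition repr_measure :: "'a measure" where
  "repr_measure = measure_of UNIV (sets borel) outer"

lemma sets_repr_measure [simp, measurable_cong]: "sets repr_measure = sets borel"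
  by (simp add: repr_measure_def sets.sigma_sets_eq[of borel, simplified])

lemma space_repr_measure [simp]: "space repr_measure = UNIV"
  by (simp add: repr_measure_def)

lemma emeasure_repr_measure: "A \<in> sets borel \<Longrightarrow> emeasure repr_measure A = outer A"
  using measure_space_outer unfolding repr_measure_def
  by (intro emeasure_measure_of_sigma) (auto simp: measure_space_def)

lemma prob_repr_measure: "prob_space repr_measure"
  by (rule prob_spaceI) (simp add: emeasure_repr_measure outer_open content_UNIV)

text \<open>Slice \<open>f\<close> horizontally into \<open>n\<close> layers of height \<open>1/n\<close>; each rescaled layer is subordinate
  to a superlevel set of \<open>f\<close>.\<close>

lemma L_le_integral_unit:
  assumes fc: "continuous_on UNIV f" and f01: "\<And>x. 0 \<le> f x" "\<And>x. f x \<le> 1"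
  shows "L f \<le> (\<integral>x. f x \<partial>repr_measure)"
proof (rule field_le_epsilon)
  fix e :: real assume "0 < e"
  interpret prob_space repr_measure by (rule prob_repr_measure)
  have [measurable]: "f \<in> borel_measurable repr_measure"
    using borel_measurable_continuous_onI[OF fc] by simp
  obtain n :: nat where n: "n > 0" "1 / n < e"
    using \<open>0 < e\<close> by (metis nat_approx_posE of_nat_0_less_iff zero_less_Suc)
  define q where "q k x = max 0 (min 1 (real n * f x - real k))" for k x
  have qc: "continuous_on UNIV (q k)" for k
    unfolding q_def by (intro continuous_intros fc)
  define U where "U k = {x. f x > k / n}" for k :: nat
  have Uo: "open (U k)" for k
    unfolding U_def by (intro open_Collect_less fc continuous_intros)
  have Ub [measurable]: "U k \<in> sets repr_measure" for k
    using Uo by simp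
  have Ui [simp]: "integrable repr_measure (indicat_real (U k))" for k
    using Ub by (intro integrable_real_indicator) (auto simp: less_top[symmetric])
  have q: "q k \<in> subordinate (U k)" for k
    using qc n by (auto simp: subordinate_def q_def U_def indicator_def field_simps)
  have slices: "(\<Sum>k<m. q k x) = min (real m) (real n * f x)" for m x
    by (induction m) (use f01(1)[of x] in \<open>auto simp: q_def min_def max_def\<close>)
  have "real n * L f = L (\<lambda>x. real n * f x)" by (simp add: scale fc)
  also have "(\<lambda>x. real n * f x) = (\<lambda>x. \<Sum>k<n. q k x)"
    using f01(2) n by (auto simp: slices min_def fun_eq_iff mult_le_cancel_left1 intro: antisym)
  also have "L \<dots> = (\<Sum>k<n. L (q k))" by (intro L_sum qc) auto
  also have "\<dots> \<le> (\<Sum>k<n. measure repr_measure (U k))"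
  proof (rule sum_mono)
    fix k
    have "ennreal (L (q k)) \<le> ennreal (measure repr_measure (U k))"
      using le_content[OF q[of k]] Uo[of k]
      by (simp add: emeasure_eq_measure[symmetric] emeasure_repr_measure outer_open)
    then show "L (q k) \<le> measure repr_measure (U k)" by simp
  qed
  also have "\<dots> = (\<integral>x. (\<Sum>k<n. indicator (U k) x) \<partial>repr_measure)"
    by (subst Bochner_Integration.integral_sum) auto
  also have "\<dots> \<le> (\<integral>x. real n * f x + 1 \<partial>repr_measure)"
  proof (rule integral_mono)
    show "integrable repr_measure (\<lambda>x. real n * f x + 1)"
      using f01 by (intro Bochner_Integration.integrable_add integrable_mult_right integrable_const_bound[of _ 1]) auto
    fix x
    \<comment> \<open>At most \<open>n f x + 1\<close> indices \<open>k\<close> satisfy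
      \<open>k < n f x\<close>. The minimum with \<open>m\<close> strengthens the induction: when
      the new indicator is 1, the old bound \<open>m\<close> is below \<open>n f x\<close>, so
      adding 1 stays below \<open>n f x + 1\<close>.\<close>
    have "(\<Sum>k<m. indicator (U k) x) \<le> min (real m) (real n * f x + 1)" for m
    proof (induction m)
      case 0 show ?case using f01(1)[of x] by simp
    next
      case (Suc m)
      show ?case
      proof (cases "x \<in> U m")
        case True
        then have "real m < real n * f x" using n by (simp add: U_def field_simps)
        then show ?thesis using Suc True by (simp add: min_def split: if_splits)
      next
        case False
        then show ?thesis using Suc by (simp add: min_def split: if_splits)
      qed
    qed
    then show "(\<Sum>k<n. indicator (U k) x) \<le> real n * f x + 1" by (metis min.boundedE)
  qed (auto intro!: Bochner_Integration.integrable_sum)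
  also have "\<dots> = real n * (\<integral>x. f x \<partial>repr_measure) + 1"
    using f01 prob_space by (subst Bochner_Integration.integral_add) (auto intro!: integrable_const_bound[of _ 1])
  finally have "L f \<le> (\<integral>x. f x \<partial>repr_measure) + 1 / n"
    using n by (simp add: field_simps)
  then show "L f \<le> (\<integral>x. f x \<partial>repr_measure) + e" using n by simp
qed

text \<open>The map g -> (g + B) / (2B) carries functions bounded by \<open>B\<close> into [0,1], so
  the one-sided inequality extends to all continuous functions; applying it to -f as well gives
  equality.\<close>

lemma L_eq_integral:
  assumes fc: "continuous_on UNIV f"
  shows "L f = (\<integral>x. f x \<partial>repr_measure)"
proof -
  interpret prob_space repr_measure by (rule prob_repr_measure)
  have "bounded (range f)"
    using compact_continuous_image[OF fc compact_space] compact_imp_bounded by blast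
  then obtain B where B: "\<And>x. \<bar>f x\<bar> \<le> B" "B > 0"
    by (auto simp: bounded_pos)
  have [measurable]: "f \<in> borel_measurable repr_measure"
    using borel_measurable_continuous_onI[OF fc] by simp
  have int: "integrable repr_measure f"
    using B by (intro integrable_const_bound[of _ B]) auto
  have le: "L g \<le> (\<integral>x. g x \<partial>repr_measure)"
    if gc: "continuous_on UNIV g" and g: "integrable repr_measure g" "\<And>x. \<bar>g x\<bar> \<le> B" for g
  proof -
    let ?g = "\<lambda>x. 1 / (2 * B) * (g x + B)"
    have "L ?g \<le> (\<integral>x. ?g x \<partial>repr_measure)"
    proof (rule L_le_integral_unit)
      show "0 \<le> ?g x" "?g x \<le> 1" for x using g(2)[of x] B(2) by (auto simp: field_simps)
    qed (intro continuous_intros gc)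
    moreover have "L ?g = 1 / (2 * B) * (L g + B)"
      by (subst scale) (auto simp: add gc const intro!: continuous_intros)
    moreover have "(\<integral>x. ?g x \<partial>repr_measure) = 1 / (2 * B) * ((\<integral>x. g x \<partial>repr_measure) + B)"
      using g prob_space by simp
    ultimately show ?thesis using B(2) by (simp add: field_simps)
  qed
  have "L (\<lambda>x. - 1 * f x) \<le> (\<integral>x. - 1 * f x \<partial>repr_measure)"
    using B int by (intro le continuous_intros fc) auto
  then have "- L f \<le> - (\<integral>x. f x \<partial>repr_measure)"
    by (subst (asm) scale[OF fc]) simp
  then show ?thesis using le[OF fc int B(1)] by simp
qed

end

subsection \<open>Hahn-Banach and subgradients on spaces of continuous functions\<close>

text \<open>A bound valid for all independent pairs of indices survives taking the two infima
  separately. It proves convexity of both infima in the Hahn-Banach argument below: over a chain of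
  minorants and over a translation parameter.\<close>

lemma le_convex_comb_cINF:
  fixes f g :: "'i \<Rightarrow> real"
  assumes ne: "I \<noteq> {}" "J \<noteq> {}" and bdd: "bdd_below (f ` I)" "bdd_below (g ` J)"
    and ab: "0 \<le> a" "0 \<le> b" "a + b = 1"
    and le: "\<And>i j. i \<in> I \<Longrightarrow> j \<in> J \<Longrightarrow> c \<le> a * f i + b * g j"
  shows "c \<le> a * (INF i\<in>I. f i) + b * (INF j\<in>J. g j)"
proof (rule field_le_epsilon)
  fix e :: real assume e: "0 < e"
  obtain i where i: "i \<in> I" "f i < (INF i\<in>I. f i) + e"
    using cINF_less_iff[OF ne(1) bdd(1), of "(INF i\<in>I. f i) + e"] e by auto
  obtain j where j: "j \<in> J" "g j < (INF j\<in>J. g j) + e"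
    using cINF_less_iff[OF ne(2) bdd(2), of "(INF j\<in>J. g j) + e"] e by auto
  have "c \<le> a * f i + b * g j" by (rule le[OF i(1) j(1)])
  also have "\<dots> \<le> a * ((INF i\<in>I. f i) + e) + b * ((INF j\<in>J. g j) + e)"
    using i j ab by (intro add_mono mult_left_mono) auto
  also have "\<dots> = a * (INF i\<in>I. f i) + b * (INF j\<in>J. g j) + (a + b) * e"
    by (simp add: algebra_simps)
  finally show "c \<le> a * (INF i\<in>I. f i) + b * (INF j\<in>J. g j) + e" by (simp add: ab)
qed

text \<open>A pointwise minimal element among the convex minorants of \<open>p\<close> vanishing at the origin is
  linear: it coincides with its rescalings \<open>x \<mapsto> m (\<lambda> x) / \<lambda>\<close> and with
  \<open>x \<mapsto> inf\<^sub>t m (x + t v) - t m v\<close>, which are again such minorants below \<open>m\<close>.\<close>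

theorem linear_minorant_of_convex:
  fixes p :: "'v::real_vector \<Rightarrow> real"
  assumes p: "convex_on UNIV p" "p 0 = 0"
  shows "\<exists>l. linear l \<and> (\<forall>x. l x \<le> p x)"
proof -
  define A where "A = {q. convex_on UNIV q \<and> q 0 = 0 \<and> q \<le> p}"
  \<comment> \<open>The order is reversed, so the maximal element delivered by Zorn's lemma is a
    pointwise minimal minorant.\<close>
  define P where "P = (\<lambda>q r :: 'v \<Rightarrow> real. r \<le> q)"
  have cvxD: "q (a *\<^sub>R x + b *\<^sub>R y) \<le> a * q x + b * q y"
    if "convex_on UNIV q" "0 \<le> a" "0 \<le> b" "a + b = 1" for q :: "'v \<Rightarrow> real" and a b x y
    using that by (simp add: convex_on_def)
  \<comment> \<open>0 is the midpoint of x and -x and \<open>q 0 = 0\<close>, hence q(x) >= -q(-x)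
    >= -p(-x). The bound is independent of \<open>q\<close>, so pointwise infima of nonempty chains
    are finite.\<close>
  have lower: "- p (- x) \<le> q x" if q: "q \<in> A" for q x
  proof -
    have "q ((1/2) *\<^sub>R x + (1/2) *\<^sub>R (- x)) \<le> (1/2) * q x + (1/2) * q (- x)"
      using q by (intro cvxD) (auto simp: A_def)
    moreover have "q (- x) \<le> p (- x)" "q 0 = 0" using q by (auto simp: A_def le_fun_def)
    ultimately show ?thesis by (simp flip: scaleR_right_distrib)
  qed
  have "\<exists>m\<in>A. \<forall>q\<in>A. P m q \<longrightarrow> q = m"
  proof (rule predicate_Zorn)
    show "partial_order_on A (relation_of P A)"
      by (auto simp: partial_order_on_def preorder_on_def refl_on_def trans_def antisym_def
          relation_of_def P_def intro: antisym)
    fix C assume C: "C \<in> Chains (relation_of P A)"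
    then have CA: "C \<subseteq> A" and ch: "\<And>q r. q \<in> C \<Longrightarrow> r \<in> C \<Longrightarrow> q \<le> r \<or> r \<le> q"
      by (auto simp: Chains_def relation_of_def P_def)
    show "\<exists>u\<in>A. \<forall>a\<in>C. P a u"
    proof (cases "C = {}")
      case True
      then show ?thesis using p by (auto simp: A_def)
    next
      case False
      define u where "u x = (INF q\<in>C. q x)" for x
      have bdd: "bdd_below ((\<lambda>q. q x) ` C)" for x
        using lower CA by (intro bdd_belowI[of _ "- p (- x)"]) auto
      have ule: "u \<le> q" if "q \<in> C" for q
        unfolding le_fun_def u_def using bdd that by (auto intro: cINF_lower)
      have "convex_on UNIV u"
        unfolding convex_on_def
      proof (intro conjI ballI allI impI)
        fix x y and a b :: real assume ab: "0 \<le> a" "0 \<le> b" "a + b = 1"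
        have "u (a *\<^sub>R x + b *\<^sub>R y) \<le> a * q x + b * r y" if qr: "q \<in> C" "r \<in> C" for q r
        proof -
          obtain s where s: "s \<in> C" "s \<le> q" "s \<le> r" using ch[OF qr] qr by blast
          have "u (a *\<^sub>R x + b *\<^sub>R y) \<le> s (a *\<^sub>R x + b *\<^sub>R y)"
            using ule[OF s(1)] by (simp add: le_fun_def)
          also have "\<dots> \<le> a * s x + b * s y" using s CA ab by (intro cvxD) (auto simp: A_def)
          also have "\<dots> \<le> a * q x + b * r y"
            using s ab by (intro add_mono mult_left_mono) (auto simp: le_fun_def)
          finally show ?thesis .
        qed
        then show "u (a *\<^sub>R x + b *\<^sub>R y) \<le> a * u x + b * u y"
          unfolding u_def[of x] u_def[of y] using False bdd ab by (intro le_convex_comb_cINF)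
      qed simp
      moreover have "u 0 = 0"
      proof -
        have "u 0 = (INF q\<in>C. 0)" unfolding u_def using CA by (intro INF_cong) (auto simp: A_def)
        then show ?thesis using False by simp
      qed
      moreover have "u \<le> p"
        using False ule CA by (auto simp: A_def intro: order_trans)
      ultimately show ?thesis using ule by (auto simp: A_def P_def)
    qed
  qed
  then obtain m where m: "m \<in> A" and min: "\<And>q. q \<in> A \<Longrightarrow> q \<le> m \<Longrightarrow> q = m"
    by (auto simp: P_def)
  have mc: "convex_on UNIV m" and m0: "m 0 = 0" and mp: "m \<le> p" using m by (auto simp: A_def)
  \<comment> \<open>Convexity together with \<open>m 0 = 0\<close> puts the rescaled function below
    \<open>m\<close> only for factors at most 1; larger factors follow by scaling back.\<close>
  have hom1: "m (c *\<^sub>R x) = c * m x" if c: "0 < c" "c \<le> 1" for c x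
  proof -
    define q where "q x = m (c *\<^sub>R x) / c" for x
    have "q \<le> m"
      unfolding le_fun_def
    proof
      fix x
      have "m (c *\<^sub>R x + (1 - c) *\<^sub>R 0) \<le> c * m x + (1 - c) * m 0"
        using c by (intro cvxD mc) auto
      then show "q x \<le> m x" using c by (simp add: q_def m0 field_simps)
    qed
    moreover have "convex_on UNIV q"
      unfolding convex_on_def
    proof (intro conjI ballI allI impI)
      fix x y and a b :: real assume ab: "0 \<le> a" "0 \<le> b" "a + b = 1"
      have "m (a *\<^sub>R (c *\<^sub>R x) + b *\<^sub>R (c *\<^sub>R y)) \<le> a * m (c *\<^sub>R x) + b * m (c *\<^sub>R y)"
        using ab by (intro cvxD mc)
      then show "q (a *\<^sub>R x + b *\<^sub>R y) \<le> a * q x + b * q y"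
        using c by (simp add: q_def divide_simps algebra_simps)
    qed simp
    ultimately have "q = m" using mp m0 by (intro min) (auto simp: A_def q_def)
    then have "q x = m x" by simp
    then show ?thesis using c by (simp add: q_def field_simps)
  qed
  have hom: "m (c *\<^sub>R x) = c * m x" if c: "0 < c" for c x
  proof (cases "c \<le> 1")
    case True then show ?thesis using hom1 c by simp
  next
    case False
    then have "m ((1 / c) *\<^sub>R (c *\<^sub>R x)) = 1 / c * m (c *\<^sub>R x)" using c by (intro hom1) auto
    then show ?thesis using c by simp
  qed
  have sub: "m (x + y) \<le> m x + m y" for x y
  proof -
    have "m ((1/2) *\<^sub>R (2 *\<^sub>R x) + (1/2) *\<^sub>R (2 *\<^sub>R y)) \<le> (1/2) * m (2 *\<^sub>R x) + (1/2) * m (2 *\<^sub>R y)"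
      by (intro cvxD mc) auto
    then show ?thesis by (simp add: hom)
  qed
  have add: "m (x + v) = m x + m v" for x v
  proof -
    define f where "f x t = m (x + t *\<^sub>R v) - t * m v" for x t
    define r where "r x = (INF t\<in>{0..}. f x t)" for x
    have bdd: "bdd_below (f x ` {0..})" for x
    proof (rule bdd_belowI2)
      fix t :: real assume t: "t \<in> {0..}"
      have "t * m v = m (t *\<^sub>R v)" using t hom[of t v] m0 by (cases "t = 0") auto
      also have "\<dots> = m ((x + t *\<^sub>R v) + - x)" by simp
      also have "\<dots> \<le> m (x + t *\<^sub>R v) + m (- x)" by (rule sub)
      finally show "- m (- x) \<le> f x t" by (simp add: f_def)
    qed
    have rle: "r x \<le> f x t" if "0 \<le> t" for x t
      unfolding r_def using that bdd by (intro cINF_lower) auto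
    have "r \<le> m" using rle[of 0] by (simp add: le_fun_def f_def)
    moreover have "r 0 = 0"
    proof -
      have "f 0 t = 0" if "0 \<le> t" for t
        using that hom[of t v] m0 by (cases "t = 0") (auto simp: f_def)
      then have "r 0 = (INF t\<in>{0::real..}. 0)" unfolding r_def by (intro INF_cong) auto
      then show ?thesis by simp
    qed
    moreover have "convex_on UNIV r"
      unfolding convex_on_def
    proof (intro conjI ballI allI impI)
      fix x y and a b :: real assume ab: "0 \<le> a" "0 \<le> b" "a + b = 1"
      have "r (a *\<^sub>R x + b *\<^sub>R y) \<le> a * f x s + b * f y t" if st: "s \<in> {0..}" "t \<in> {0..}" for s t
      proof -
        \<comment> \<open>\<open>f\<close> is jointly convex in point and parameter, because the
          subtracted term is linear in the parameter. Mixing \<open>s\<close> and \<open>t\<close>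
          with the weights of \<open>x\<close> and \<open>y\<close> therefore makes the partial
          infimum \<open>r\<close> convex.\<close>
        have "r (a *\<^sub>R x + b *\<^sub>R y) \<le> f (a *\<^sub>R x + b *\<^sub>R y) (a * s + b * t)"
          using st ab by (intro rle) auto
        also have "(a *\<^sub>R x + b *\<^sub>R y) + (a * s + b * t) *\<^sub>R v
            = a *\<^sub>R (x + s *\<^sub>R v) + b *\<^sub>R (y + t *\<^sub>R v)" by (simp add: algebra_simps)
        then have "f (a *\<^sub>R x + b *\<^sub>R y) (a * s + b * t) \<le> a * f x s + b * f y t"
          using cvxD[OF mc ab, of "x + s *\<^sub>R v" "y + t *\<^sub>R v"] by (simp add: f_def algebra_simps)
        finally show ?thesis .
      qed
      then show "r (a *\<^sub>R x + b *\<^sub>R y) \<le> a * r x + b * r y"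
        unfolding r_def[of x] r_def[of y] using bdd ab by (intro le_convex_comb_cINF) auto
    qed simp
    ultimately have "r = m" using mp by (intro min) (auto simp: A_def)
    then have "m x + m v \<le> m (x + v)" using rle[of 1 x] by (simp add: f_def)
    then show ?thesis using sub[of x v] by simp
  qed
  have neg: "m (- x) = - m x" for x using add[of x "- x"] m0 by simp
  have "linear m"
  proof (rule linearI)
    fix c :: real and x
    consider "c = 0" | "0 < c" | "c < 0" by linarith
    then show "m (c *\<^sub>R x) = c *\<^sub>R m x"
    proof cases
      case 3
      then show ?thesis using hom[of "- c" x] neg[of "c *\<^sub>R x"] by simp
    qed (auto simp: m0 hom)
  qed (rule add)
  then show ?thesis using mp by (auto simp: le_fun_def)
qed

section \<open>Riesz representation and subgradients for functionals on C(Y)\<close>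

lemma apply_Bcontfun:
  fixes f :: "'a::metric_space \<Rightarrow> real"
  assumes "compact (UNIV :: 'a set)" "continuous_on UNIV f"
  shows "apply_bcontfun (Bcontfun f) = f"
  using assms compact_continuous_image[of UNIV f] compact_imp_bounded
  by (intro Bcontfun_inverse) (auto simp: bcontfun_def)

lemma Riesz_representation:
  fixes l :: "('b::metric_space \<Rightarrow>\<^sub>C real) \<Rightarrow> real"
  assumes compact: "compact (UNIV :: 'b set)"
    and add: "\<And>g h. l (g + h) = l g + l h" and scale: "\<And>c g. l (c *\<^sub>R g) = c * l g"
    and pos: "\<And>g. (\<And>y. 0 \<le> apply_bcontfun g y) \<Longrightarrow> 0 \<le> l g"
    and const: "l (const_bcontfun 1) = 1"
  shows "\<exists>\<sigma>\<in>prob_measures. \<forall>g. l g = (\<integral>y. apply_bcontfun g y \<partial>\<sigma>)"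
proof -
  note ap = apply_Bcontfun[OF compact]
  \<comment> \<open>\<open>Bcontfun\<close> is meaningful only on bounded continuous functions,
    which is why the locale demands its laws for continuous arguments only.\<close>
  interpret mean_functional "\<lambda>f. l (Bcontfun f)"
  proof
    fix f g :: "'b \<Rightarrow> real" assume f: "continuous_on UNIV f" and g: "continuous_on UNIV g"
    have "Bcontfun (\<lambda>x. f x + g x) = Bcontfun f + Bcontfun g"
      by (rule bcontfun_eqI) (simp add: ap f g continuous_on_add)
    then show "l (Bcontfun (\<lambda>x. f x + g x)) = l (Bcontfun f) + l (Bcontfun g)"
      by (simp add: add)
    assume "\<And>x. f x \<le> g x"
    then have "0 \<le> l (Bcontfun g + (- 1) *\<^sub>R Bcontfun f)"
      by (intro pos) (simp add: ap f g)
    then show "l (Bcontfun f) \<le> l (Bcontfun g)"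
      unfolding add scale by simp
  next
    fix f :: "'b \<Rightarrow> real" and c assume f: "continuous_on UNIV f"
    have "Bcontfun (\<lambda>x. c * f x) = c *\<^sub>R Bcontfun f"
      by (rule bcontfun_eqI) (simp add: ap f continuous_on_mult_left)
    then show "l (Bcontfun (\<lambda>x. c * f x)) = c * l (Bcontfun f)" by (simp add: scale)
  next
    fix c :: real
    have "Bcontfun (\<lambda>_::'b. c) = c *\<^sub>R const_bcontfun 1"
      by (rule bcontfun_eqI) (simp add: ap const_bcontfun.rep_eq)
    then show "l (Bcontfun (\<lambda>_. c)) = c" by (simp add: scale const)
  qed (rule compact)
  have "repr_measure \<in> prob_measures"
    using prob_repr_measure by (simp add: prob_measures_def)
  moreover have "l g = (\<integral>y. apply_bcontfun g y \<partial>repr_measure)" for g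
    using L_eq_integral[of "apply_bcontfun g"] by (simp add: apply_bcontfun_inverse)
  ultimately show ?thesis by blast
qed

text \<open>The conclusion says that the supremum defining the conjugate of \<open>p\<close> at
  \<sigma> is attained at \<open>g0\<close>. This form gives the hard inequality of
  \<open>biconjugate\<close> directly.\<close>

theorem subgradient_measure:
  fixes p :: "('b::metric_space \<Rightarrow>\<^sub>C real) \<Rightarrow> real"
  assumes compact: "compact (UNIV :: 'b set)" and cvx: "convex_on UNIV p"
    and mono: "\<And>g h. (\<And>y. apply_bcontfun g y \<le> apply_bcontfun h y) \<Longrightarrow> p g \<le> p h"
    and const: "\<And>g c. p (g + const_bcontfun c) = p g + c"
  shows "\<exists>\<sigma>\<in>prob_measures. \<forall>g.
    (\<integral>y. apply_bcontfun g y \<partial>\<sigma>) - p g \<le> (\<integral>y. apply_bcontfun g0 y \<partial>\<sigma>) - p g0"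
proof -
  define q where "q h = p (g0 + h) - p g0" for h
  have "convex_on UNIV q"
    unfolding convex_on_def
  proof (intro conjI ballI allI impI)
    fix g h and a b :: real assume ab: "0 \<le> a" "0 \<le> b" "a + b = 1"
    have "p (a *\<^sub>R (g0 + g) + b *\<^sub>R (g0 + h)) \<le> a * p (g0 + g) + b * p (g0 + h)"
      using cvx ab by (simp add: convex_on_def)
    moreover have "a *\<^sub>R (g0 + g) + b *\<^sub>R (g0 + h) = (a + b) *\<^sub>R g0 + (a *\<^sub>R g + b *\<^sub>R h)"
      by (simp add: algebra_simps)
    then have "a *\<^sub>R (g0 + g) + b *\<^sub>R (g0 + h) = g0 + (a *\<^sub>R g + b *\<^sub>R h)"
      unfolding ab by simp
    moreover have "p g0 = a * p g0 + b * p g0" using ab by (simp flip: distrib_right)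
    ultimately show "q (a *\<^sub>R g + b *\<^sub>R h) \<le> a * q g + b * q h"
      unfolding q_def by (simp add: right_diff_distrib)
  qed simp
  then obtain l where l: "linear l" and le: "\<And>h. l h \<le> q h"
    using linear_minorant_of_convex[of q] by (auto simp: q_def)
  have "l (const_bcontfun c) \<le> c" for c
    using le[of "const_bcontfun c"] by (simp add: q_def const)
  \<comment> \<open>The two signs turn the one-sided bound into l(1) = 1: the bound at -1 reads
    -l(1) <= -1.\<close>
  note le1 = this[of 1] this[of "- 1"]
  have "l (const_bcontfun 1) = 1"
  proof -
    have "(const_bcontfun (- 1) :: 'b \<Rightarrow>\<^sub>C real) = - const_bcontfun 1"
      by (rule bcontfun_eqI) (simp add: const_bcontfun.rep_eq)
    then show ?thesis
      using le1 linear_neg[OF l, of "const_bcontfun 1"] by simp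
  qed
  moreover have "0 \<le> l g" if "\<And>y. 0 \<le> apply_bcontfun g y" for g
  proof -
    have "p (g0 + - g) \<le> p g0" by (intro mono) (simp add: that)
    then have "l (- g) \<le> 0" using le[of "- g"] by (simp add: q_def)
    then show ?thesis using linear_neg[OF l, of g] by simp
  qed
  ultimately obtain \<sigma> where \<sigma>: "\<sigma> \<in> prob_measures" "\<And>g. l g = (\<integral>y. apply_bcontfun g y \<partial>\<sigma>)"
    using Riesz_representation[OF compact, of l] linear_add[OF l] linear_scale[OF l] by auto
  have "l g - l g0 \<le> p g - p g0" for g
    using le[of "g - g0"] linear_diff[OF l, of g g0] by (simp add: q_def)
  then show ?thesis using \<sigma> by (intro bexI[of _ \<sigma>]) (auto simp: algebra_simps)
qed

subsection \<open>Integrals of functions bounded above\<close>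

lemma prob_measuresD:
  assumes "\<mu> \<in> prob_measures"
  shows "prob_space \<mu>" "sets \<mu> = sets borel" "space \<mu> = UNIV"
  using assms sets_eq_imp_space_eq[of \<mu> borel] by (auto simp: prob_measures_def)

text \<open>A normal form with one nonnegative integrand in place of a difference of two integrals.
  It lets every later property be derived in \<open>ennreal\<close>, where an infinite integral of C
  - f simply stands for the value -infinity.\<close>

lemma ereal_integral_eq:
  assumes \<mu>: "\<mu> \<in> prob_measures" and f: "f \<in> borel_measurable borel"
    and le: "\<And>x. f x \<le> ereal C" and C: "0 \<le> C"
  shows "ereal_integral \<mu> f = ereal C - enn2ereal (\<integral>\<^sup>+x. e2ennreal (ereal C - f x) \<partial>\<mu>)"
proof -
  interpret prob_space \<mu> using prob_measuresD[OF \<mu>] by simp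
  note [measurable_cong] = prob_measuresD(2)[OF \<mu>] and [measurable] = f
  let ?P = "\<integral>\<^sup>+x. e2ennreal (f x) \<partial>\<mu>" and ?N = "\<integral>\<^sup>+x. e2ennreal (- f x) \<partial>\<mu>"
    and ?J = "\<integral>\<^sup>+x. e2ennreal (ereal C - f x) \<partial>\<mu>"
  \<comment> \<open>Pointwise (C - f) + f^+ = C + f^-, stated without subtraction so that it can be
    integrated even where f is -infinity. The integral of f^+ is at most C, hence may be cancelled
    afterwards.\<close>
  have "e2ennreal (ereal C - f x) + e2ennreal (f x) = ennreal C + e2ennreal (- f x)" for x
  proof (cases "f x")
    case (real r)
    then show ?thesis using le[of x] C
      by (cases "0 \<le> r") (auto simp: e2ennreal_ereal ennreal_neg simp flip: ennreal_plus)
  next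
    case MInf
    then show ?thesis by (simp add: e2ennreal_neg flip: top_ennreal.abs_eq)
  qed (use le[of x] in simp)
  then have "(\<integral>\<^sup>+x. e2ennreal (ereal C - f x) + e2ennreal (f x) \<partial>\<mu>)
      = (\<integral>\<^sup>+x. ennreal C + e2ennreal (- f x) \<partial>\<mu>)" by simp
  then have eq: "?J + ?P = ennreal C + ?N"
    by (simp add: nn_integral_add emeasure_space_1)
  have "?P \<le> (\<integral>\<^sup>+x. ennreal C \<partial>\<mu>)"
    using le by (intro nn_integral_mono) (metis e2ennreal_ereal e2ennreal_mono)
  then have "?P \<le> ennreal C" by (simp add: emeasure_space_1)
  then have "?P < top" by (metis ennreal_less_top order_le_less_trans)
  then obtain p where p: "?P = ennreal p" "0 \<le> p" by (metis ennreal_cases less_irrefl)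
  show ?thesis
    unfolding ereal_integral_def
  proof (cases ?N rule: ennreal_cases)
    case top
    then have "?J = top" using eq p by (cases ?J rule: ennreal_cases) (auto simp flip: ennreal_plus)
    then show "enn2ereal ?P - enn2ereal ?N = ereal C - enn2ereal ?J" using top p by simp
  next
    case (real n)
    then obtain j where "?J = ennreal j" "0 \<le> j" using eq p C
      by (cases ?J rule: ennreal_cases) (auto simp flip: ennreal_plus)
    then show "enn2ereal ?P - enn2ereal ?N = ereal C - enn2ereal ?J"
      using real eq p C by (simp flip: ennreal_plus)
  qed
qed

text \<open>The prescribed lower bound \<open>B\<close> allows the constant to be chosen together
  with other data: large enough to stay nonnegative after a shift, or to bound two functions at
  once.\<close>

lemma bounded_aboveE:
  assumes "bounded_above f"
  obtains C where "0 \<le> C" "B \<le> C" "\<And>x. f x \<le> ereal C"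
proof -
  obtain D where D: "\<And>x. f x \<le> ereal D" using assms by (auto simp: bounded_above_def)
  have "f x \<le> ereal (max 0 (max B D))" for x
    using D[of x] by (rule order_trans) (unfold ereal_less_eq, simp)
  then show ?thesis by (intro that[of "max 0 (max B D)"]) auto
qed

lemma ereal_integral_mono: "(\<And>x. f x \<le> h x) \<Longrightarrow> ereal_integral \<mu> f \<le> ereal_integral \<mu> h"
  unfolding ereal_integral_def
  by (intro ereal_minus_mono nn_integral_mono e2ennreal_mono)
    (auto simp: less_eq_ennreal.rep_eq[symmetric] intro!: nn_integral_mono e2ennreal_mono)

lemma ereal_integral_ereal:
  assumes \<mu>: "\<mu> \<in> prob_measures" and f: "f \<in> borel_measurable borel" and le: "\<And>x. \<bar>f x\<bar> \<le> B"
  shows "ereal_integral \<mu> (\<lambda>x. ereal (f x)) = ereal (\<integral>x. f x \<partial>\<mu>)"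
proof -
  interpret prob_space \<mu> using prob_measuresD[OF \<mu>] by simp
  note [measurable_cong] = prob_measuresD(2)[OF \<mu>] and [measurable] = f
  have B: "0 \<le> B" using le[of undefined] by simp
  have int: "integrable \<mu> f" using le by (intro integrable_const_bound[of _ B]) auto
  have f2: "f x \<le> B" for x using le[of x] by simp
  have "(\<integral>\<^sup>+x. ennreal (B - f x) \<partial>\<mu>) = ennreal (\<integral>x. B - f x \<partial>\<mu>)"
    using f2 int by (intro nn_integral_eq_integral) auto
  also have "(\<integral>x. B - f x \<partial>\<mu>) = B - (\<integral>x. f x \<partial>\<mu>)"
    using int prob_space by simp
  finally have eq: "(\<integral>\<^sup>+x. ennreal (B - f x) \<partial>\<mu>) = ennreal (B - (\<integral>x. f x \<partial>\<mu>))" .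
  have "(\<integral>x. f x \<partial>\<mu>) \<le> B" using f2 int by (intro integral_le_const) auto
  then show ?thesis
    using f2 B by (subst ereal_integral_eq[OF \<mu> _ _ B]) (auto simp: eq)
qed

lemma ereal_integral_le:
  assumes "\<mu> \<in> prob_measures" "f \<in> borel_measurable borel" "\<And>x. f x \<le> ereal C" "0 \<le> C"
  shows "ereal_integral \<mu> f \<le> ereal C"
  unfolding ereal_integral_eq[OF assms] by (cases "\<integral>\<^sup>+x. e2ennreal (ereal C - f x) \<partial>\<mu>" rule: ennreal_cases) auto

lemma ereal_integral_neq_PInf:
  assumes \<mu>: "\<mu> \<in> prob_measures" and f: "f \<in> bounded_above_borel"
  shows "ereal_integral \<mu> f \<noteq> \<infinity>"
proof -
  have "bounded_above f" using f by (simp add: bounded_above_borel_def)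
  then obtain C where "0 \<le> C" "\<And>x. f x \<le> ereal C" by (rule bounded_aboveE[where B=0]) auto
  then have "ereal_integral \<mu> f \<le> ereal C"
    using f \<mu> by (intro ereal_integral_le) (auto simp: bounded_above_borel_def)
  then show ?thesis by auto
qed

lemma ereal_integral_add_const:
  assumes \<mu>: "\<mu> \<in> prob_measures" and f: "f \<in> bounded_above_borel"
  shows "ereal_integral \<mu> (\<lambda>x. f x + ereal c) = ereal_integral \<mu> f + ereal c"
proof -
  have fm: "f \<in> borel_measurable borel" and "bounded_above f"
    using f by (auto simp: bounded_above_borel_def)
  from \<open>bounded_above f\<close> obtain C where C: "0 \<le> C" "- c \<le> C" "\<And>x. f x \<le> ereal C"
    by (rule bounded_aboveE) auto
  have le: "f x + ereal c \<le> ereal (C + c)" for x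
    using add_right_mono[OF C(3)[of x], of "ereal c"] by simp
  have "ereal (C + c) - (f x + ereal c) = ereal C - f x" for x
    by (cases "f x") auto
  then have "ereal_integral \<mu> (\<lambda>x. f x + ereal c)
      = ereal (C + c) - enn2ereal (\<integral>\<^sup>+x. e2ennreal (ereal C - f x) \<partial>\<mu>)"
    using C le fm by (subst ereal_integral_eq[OF \<mu> _ le]) auto
  also have "\<dots> = ereal_integral \<mu> f + ereal c"
    unfolding ereal_integral_eq[OF \<mu> fm C(3,1)]
    by (cases "\<integral>\<^sup>+x. e2ennreal (ereal C - f x) \<partial>\<mu>" rule: ennreal_cases) auto
  finally show ?thesis .
qed

lemma e2ennreal_convex_comb:
  assumes "0 < t" "t < 1" "u \<le> ereal C" "v \<le> ereal C"
  shows "e2ennreal (ereal C - (ereal t * u + ereal (1 - t) * v))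
    = ennreal t * e2ennreal (ereal C - u) + ennreal (1 - t) * e2ennreal (ereal C - v)"
proof (cases u; cases v)
  fix r s assume "u = ereal r" "v = ereal s"
  moreover from this have "ennreal t * ennreal (C - r) + ennreal (1 - t) * ennreal (C - s)
    = ennreal (t * (C - r) + (1 - t) * (C - s))"
    using assms by (simp add: ennreal_mult'' ennreal_plus)
  moreover have "t * (C - r) + (1 - t) * (C - s) = C - (t * r + (1 - t) * s)"
    by (simp add: algebra_simps)
  ultimately show ?thesis by (simp add: e2ennreal_ereal)
qed (use assms in \<open>auto simp: ennreal_mult_top simp flip: top_ennreal.abs_eq\<close>)

lemma ereal_diff_convex_comb:
  fixes J K :: ennreal
  assumes "0 < t" "t < 1"
  shows "ereal C - enn2ereal (ennreal t * J + ennreal (1 - t) * K)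
    = ereal t * (ereal C - enn2ereal J) + ereal (1 - t) * (ereal C - enn2ereal K)"
proof (cases J rule: ennreal_cases; cases K rule: ennreal_cases)
  fix r s assume rs: "J = ennreal r" "0 \<le> r" "K = ennreal s" "0 \<le> s"
  then have "ennreal t * J + ennreal (1 - t) * K = ennreal (t * r + (1 - t) * s)"
    using assms by (simp add: ennreal_mult ennreal_plus)
  then have "enn2ereal (ennreal t * J + ennreal (1 - t) * K) = ereal (t * r + (1 - t) * s)"
    unfolding \<open>ennreal t * J + _ = _\<close> using rs assms by (intro enn2ereal_ennreal) auto
  then show ?thesis using rs(2,4) unfolding rs(1,3) by (simp add: enn2ereal_ennreal algebra_simps)
qed (use assms in \<open>auto simp: ennreal_mult_top ennreal_top_mult\<close>)

text \<open>With one bound C for both functions, C minus the mixture is the same mixture of the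
  nonnegative functions C - f and C - h, whose integrals are additive even when infinite.\<close>

lemma ereal_integral_convex_comb:
  assumes \<mu>: "\<mu> \<in> prob_measures" and f: "f \<in> bounded_above_borel" and h: "h \<in> bounded_above_borel"
    and t: "0 \<le> t" "t \<le> 1"
  shows "ereal_integral \<mu> (\<lambda>x. ereal t * f x + ereal (1 - t) * h x)
    = ereal t * ereal_integral \<mu> f + ereal (1 - t) * ereal_integral \<mu> h"
proof -
  consider "t = 0" | "t = 1" | "0 < t" "t < 1" using t by linarith
  then show ?thesis
  proof cases
    case 3
    have [measurable]: "f \<in> borel_measurable borel" "h \<in> borel_measurable borel"
      and bf: "bounded_above f" and bh: "bounded_above h"
      using f h by (auto simp: bounded_above_borel_def)
    note [measurable_cong] = prob_measuresD(2)[OF \<mu>]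
    from bf obtain C0 where C0: "\<And>x. f x \<le> ereal C0" by (auto simp: bounded_above_def)
    from bh obtain C where C: "0 \<le> C" "C0 \<le> C" "\<And>x. h x \<le> ereal C" by (rule bounded_aboveE[where B=C0]) auto
    have C': "f x \<le> ereal C" for x using C0[of x] C(2) by (metis ereal_less_eq(3) order_trans)
    have le: "ereal t * f x + ereal (1 - t) * h x \<le> ereal C" for x
    proof -
      have "ereal t * f x + ereal (1 - t) * h x \<le> ereal t * ereal C + ereal (1 - t) * ereal C"
        using t C' C by (intro add_mono ereal_mult_left_mono) auto
      then show ?thesis by (simp add: algebra_simps)
    qed
    show ?thesis
      unfolding ereal_integral_eq[OF \<mu> \<open>f \<in> borel_measurable borel\<close> C' C(1)]
        ereal_integral_eq[OF \<mu> \<open>h \<in> borel_measurable borel\<close> C(3,1)]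
        ereal_diff_convex_comb[OF 3, symmetric]
      using C(1) by (subst ereal_integral_eq[OF \<mu> _ le])
        (auto simp: e2ennreal_convex_comb[OF 3 C' C(3)] nn_integral_add nn_integral_cmult)
  qed (auto simp flip: zero_ereal_def)
qed

lemma return_in_prob_measures: "return borel x \<in> prob_measures"
  by (simp add: prob_measures_def prob_space_return)

lemma ereal_integral_return:
  assumes [measurable]: "f \<in> borel_measurable borel"
  shows "ereal_integral (return borel x) f = f x"
  unfolding ereal_integral_def
proof (subst (1 2) nn_integral_return)
  show "enn2ereal (e2ennreal (f x)) - enn2ereal (e2ennreal (- f x)) = f x"
  proof (cases "f x")
    case (real r)
    then show ?thesis
      by (cases "0 \<le> r") (auto simp: e2ennreal_ereal ennreal_neg enn2ereal_ennreal zero_ennreal.rep_eq)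
  qed (auto simp: e2ennreal_neg zero_ennreal.rep_eq)
qed auto

lemma ereal_integral_eq_MInf:
  assumes \<mu>: "\<mu> \<in> prob_measures" and f: "\<And>x. f x = - \<infinity>"
  shows "ereal_integral \<mu> f = - \<infinity>"
proof -
  interpret prob_space \<mu> using prob_measuresD[OF \<mu>] by simp
  have "e2ennreal \<infinity> = top" "e2ennreal (- \<infinity>) = 0" by (simp_all add: e2ennreal_neg)
  then show ?thesis
    by (simp add: ereal_integral_def f emeasure_space_1 zero_ennreal.rep_eq)
qed

text \<open>Subtraction from an upper bound C turns the decreasing sequence into an increasing
  nonnegative one, so monotone convergence applies also when the limit integral is
  -infinity.\<close>

lemma ereal_integral_INF:
  fixes F :: "nat \<Rightarrow> 'a::topological_space \<Rightarrow> real"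
  assumes \<mu>: "\<mu> \<in> prob_measures" and F [measurable]: "\<And>n. F n \<in> borel_measurable borel"
    and bdd: "\<And>n. \<exists>B. \<forall>x. \<bar>F n x\<bar> \<le> B" and dec: "\<And>n x. F (Suc n) x \<le> F n x"
  shows "ereal_integral \<mu> (\<lambda>x. INF n. ereal (F n x)) = (INF n. ereal (\<integral>x. F n x \<partial>\<mu>))"
proof -
  note [measurable_cong] = prob_measuresD(2)[OF \<mu>]
  obtain C where "\<And>x. \<bar>F 0 x\<bar> \<le> C" using bdd by blast
  then have C: "0 \<le> C" "\<And>x. F 0 x \<le> C" by (metis abs_ge_zero order_trans, metis abs_le_D1)
  have "F n x \<le> F 0 x" for n x using dec lift_Suc_antimono_le[of "\<lambda>n. F n x" 0 n] by simp
  then have le: "F n x \<le> C" for n x using C(2)[of x] by (metis order_trans)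
  have INF_le: "(INF n. ereal (F n x)) \<le> ereal C" for x
    using C(2)[of x] by (intro INF_lower2[of 0]) auto
  let ?f = "\<lambda>n x. e2ennreal (ereal C - ereal (F n x))"
  have "e2ennreal (ereal C - (INF n. ereal (F n x))) = (SUP n. ?f n x)" for x
  proof -
    have "ereal C - (INF n. ereal (F n x)) = (SUP n. ereal C - ereal (F n x))"
      by (subst SUP_ereal_minus_right) auto
    also have "e2ennreal \<dots> = (SUP n. ?f n x)"
      by (rule sup_continuousD[OF sup_continuous_e2ennreal[OF sup_continuous_id, unfolded id_def]])
        (use dec in \<open>auto simp: mono_iff_le_Suc\<close>)
    finally show ?thesis .
  qed
  then have "ereal_integral \<mu> (\<lambda>x. INF n. ereal (F n x)) = ereal C - enn2ereal (\<integral>\<^sup>+x. (SUP n. ?f n x) \<partial>\<mu>)"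
    by (subst ereal_integral_eq[OF \<mu> _ INF_le C(1)]) auto
  also have "(\<integral>\<^sup>+x. (SUP n. ?f n x) \<partial>\<mu>) = (SUP n. \<integral>\<^sup>+x. ?f n x \<partial>\<mu>)"
    using dec by (intro nn_integral_monotone_convergence_SUP)
      (auto simp: incseq_Suc_iff le_fun_def intro!: ennreal_leI)
  also have "enn2ereal \<dots> = (SUP n. enn2ereal (\<integral>\<^sup>+x. ?f n x \<partial>\<mu>))"
    by (simp add: Sup_ennreal.rep_eq image_image sup.absorb2 SUP_upper2)
  also have "ereal C - \<dots> = (INF n. ereal C - enn2ereal (\<integral>\<^sup>+x. ?f n x \<partial>\<mu>))"
    by (subst INF_ereal_minus_right) auto
  also have "\<dots> = (INF n. ereal (\<integral>x. F n x \<partial>\<mu>))"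
  proof (intro INF_cong refl)
    fix n
    obtain B where B: "\<And>x. \<bar>F n x\<bar> \<le> B" using bdd by blast
    show "ereal C - enn2ereal (\<integral>\<^sup>+x. ?f n x \<partial>\<mu>) = ereal (\<integral>x. F n x \<partial>\<mu>)"
      unfolding ereal_integral_ereal[OF \<mu> F B, symmetric]
      using le C by (subst ereal_integral_eq[OF \<mu> _ _ C(1)]) auto
  qed
  finally show ?thesis .
qed

section \<open>Upper semicontinuous functions as decreasing limits of continuous ones\<close>

lemma usc_borel_measurable: "usc f \<Longrightarrow> f \<in> borel_measurable borel"
  unfolding usc_def by (intro borel_measurableI_ge) (simp add: borel_closed)

lemma USC_bounded_above_borel: "f \<in> USC \<Longrightarrow> f \<in> bounded_above_borel"
  by (simp add: USC_def bounded_above_borel_def usc_borel_measurable)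

text \<open>The approximants are the Lipschitz envelopes sup_y (f(y) - n d(x,y)). They are
  n-Lipschitz and decrease in n; the upper bound of f together with one point where f is not
  -infinity makes them real-valued.\<close>

lemma USC_INF_continuous:
  fixes f :: "'a::metric_space \<Rightarrow> ereal"
  assumes compact: "compact (UNIV :: 'a set)" and f: "f \<in> USC"
  shows "\<exists>F :: nat \<Rightarrow> 'a \<Rightarrow>\<^sub>C real. (\<forall>n x. apply_bcontfun (F (Suc n)) x \<le> apply_bcontfun (F n) x) \<and>
    (\<forall>x. f x = (INF n. ereal (apply_bcontfun (F n) x)))"
proof -
  obtain x0 where x0: "f x0 \<noteq> - \<infinity>" using f by (auto simp: USC_def)
  have "bounded_above f" using f by (simp add: USC_def)
  then obtain C where C: "0 \<le> C" "\<And>x. f x \<le> ereal C" by (rule bounded_aboveE[where B=0]) auto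
  define E where "E n x = (SUP y. f y - ereal (real n * dist x y))" for n x
  have E_ge: "f y - ereal (real n * dist x y) \<le> E n x" for n x y
    unfolding E_def by (rule SUP_upper) simp
  have E_le: "E n x \<le> ereal C" for n x
    unfolding E_def
  proof (rule SUP_least)
    fix y
    have "f y - ereal (real n * dist x y) \<le> f y - 0" by (intro ereal_minus_mono) auto
    then show "f y - ereal (real n * dist x y) \<le> ereal C" using C(2)[of y] by simp
  qed
  have fin: "\<bar>E n x\<bar> \<noteq> \<infinity>" for n x
    using E_ge[of x0 n x] E_le[of n x] x0 C(2)[of x0] by (cases "f x0"; cases "E n x") auto
  define G where "G n x = real_of_ereal (E n x)" for n x
  have EG: "E n x = ereal (G n x)" for n x
    unfolding G_def using fin by (simp add: ereal_real')
  have lip: "G n x \<le> G n z + real n * dist x z" for n x z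
  proof -
    have "E n x \<le> E n z + ereal (real n * dist x z)"
      unfolding E_def[of n x]
    proof (rule SUP_least)
      fix y
      have "real n * dist z y \<le> real n * dist x y + real n * dist x z"
        using dist_triangle[of z y x] by (simp add: dist_commute flip: distrib_left) (simp add: mult_left_mono add.commute)
      then have "f y - ereal (real n * dist x y)
          \<le> (f y - ereal (real n * dist z y)) + ereal (real n * dist x z)"
        by (cases "f y") auto
      also have "\<dots> \<le> E n z + ereal (real n * dist x z)" by (intro add_right_mono E_ge)
      finally show "f y - ereal (real n * dist x y) \<le> E n z + ereal (real n * dist x z)" .
    qed
    then show ?thesis by (simp add: EG)
  qed
  have Gc: "continuous_on UNIV (G n)" for n
  proof (rule continuous_onI)
    fix x and e :: real assume e: "0 < e"
    have "dist (G n z) (G n x) \<le> e" if "dist z x < e / (real n + 1)" for z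
    proof -
      have "\<bar>G n z - G n x\<bar> \<le> real n * dist z x"
        using lip[of n z x] lip[of n x z] by (simp add: dist_commute abs_le_iff)
      also have "\<dots> \<le> (real n + 1) * dist z x" by (intro mult_right_mono) auto
      also have "\<dots> \<le> e" using that by (simp add: field_simps)
      finally show ?thesis by (simp add: dist_real_def)
    qed
    then show "\<exists>d>0. \<forall>z\<in>UNIV. dist z x < d \<longrightarrow> dist (G n z) (G n x) \<le> e"
      using e by (intro exI[of _ "e / (real n + 1)"]) auto
  qed
  have dec: "E (Suc n) x \<le> E n x" for n x
    unfolding E_def by (intro SUP_mono') (auto intro!: ereal_minus_mono mult_right_mono)
  have lim: "f x = (INF n. E n x)" for x
  proof (rule antisym)
    show "f x \<le> (INF n. E n x)" using E_ge[of x _ x] by (intro INF_greatest) (simp add: zero_ereal_def[symmetric])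
    show "(INF n. E n x) \<le> f x"
    \<comment> \<open>Comparing with all real upper bounds of \<open>f x\<close> also covers the
      case that \<open>f x\<close> is -infinity.\<close>
    proof (rule ereal_le_real)
      fix b assume "f x \<le> ereal b"
      show "(INF n. E n x) \<le> ereal b"
      proof (rule ereal_le_epsilon2)
        fix e :: real assume e: "0 < e"
        have "open {y. f y < ereal (b + e)}"
        proof -
          have "{y. f y < ereal (b + e)} = - {y. ereal (b + e) \<le> f y}" by (auto simp: not_le)
          then show ?thesis using f by (simp add: USC_def usc_def open_Compl)
        qed
        moreover have "x \<in> {y. f y < ereal (b + e)}"
          using \<open>f x \<le> ereal b\<close> e by (auto intro: le_less_trans)
        ultimately obtain d where d: "d > 0" "\<And>y. dist y x < d \<Longrightarrow> f y < ereal (b + e)"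
          unfolding open_dist by blast
        \<comment> \<open>At distance at least \<open>d\<close> from \<open>x\<close> the penalty n
          d(x,y) outweighs the global bound \<open>C\<close>; closer to \<open>x\<close>,
          semicontinuity already gives f(y) < b + e.\<close>
        obtain n :: nat where n: "real n \<ge> (C - b - e) / d" using real_arch_simple by blast
        have "E n x \<le> ereal (b + e)"
          unfolding E_def
        proof (rule SUP_least)
          fix y
          show "f y - ereal (real n * dist x y) \<le> ereal (b + e)"
          proof (cases "dist y x < d")
            case True
            have "f y - ereal (real n * dist x y) \<le> f y - 0" by (intro ereal_minus_mono) auto
            then show ?thesis using d(2)[OF True] by (simp add: less_imp_le order_trans)
          next
            case False
            have "C - b - e \<le> real n * d" using n d(1) by (simp add: field_simps)
            also have "\<dots> \<le> real n * dist x y"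
              using False by (intro mult_left_mono) (auto simp: dist_commute)
            finally show ?thesis using C(2)[of y] by (cases "f y") auto
          qed
        qed
        then show "(INF n. E n x) \<le> ereal b + ereal e"
          by (intro INF_lower2[of n]) auto
      qed
    qed
  qed
  show ?thesis
    using dec lim by (intro exI[of _ "\<lambda>n. Bcontfun (G n)"]) (simp add: apply_Bcontfun[OF compact Gc] EG)
qed

subsection \<open>Jordan decomposition of signed measures\<close>

lemma smeasure_notin: "A \<notin> sets borel \<Longrightarrow> smeasure \<nu> A = 0"
  using smeasure[of \<nu>] by blast

lemma smeasure_sums:
  "range A \<subseteq> sets borel \<Longrightarrow> disjoint_family A \<Longrightarrow> (\<lambda>i::nat. smeasure \<nu> (A i)) sums smeasure \<nu> (\<Union>i. A i)"
  using smeasure[of \<nu>] by blast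

lemma smeasure_empty [simp]: "smeasure \<nu> {} = 0"
proof -
  have "(\<lambda>i::nat. smeasure \<nu> {}) sums smeasure \<nu> {}"
    using smeasure_sums[of "\<lambda>_. {}" \<nu>] by (simp add: disjoint_family_on_def)
  then have "(\<lambda>i::nat. smeasure \<nu> {}) \<longlonglongrightarrow> 0" by (intro summable_LIMSEQ_zero) (rule sums_summable)
  then show ?thesis by (simp add: LIMSEQ_const_iff)
qed

lemma smeasure_Un:
  assumes A: "A \<in> sets borel" and B: "B \<in> sets borel" and "A \<inter> B = {}"
  shows "smeasure \<nu> (A \<union> B) = smeasure \<nu> A + smeasure \<nu> B"
proof -
  have "(\<lambda>i. smeasure \<nu> (binaryset A B i)) sums smeasure \<nu> (\<Union>i. binaryset A B i)"
    using assms by (intro smeasure_sums) (auto simp: range_binaryset_eq disjoint_family_on_def binaryset_def)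
  then have "(\<lambda>i. smeasure \<nu> (binaryset A B i)) sums smeasure \<nu> (A \<union> B)"
    by (simp add: UN_binaryset_eq)
  moreover have "(\<lambda>i. smeasure \<nu> (binaryset A B i)) sums (\<Sum>i\<in>{0, 1}. smeasure \<nu> (binaryset A B i))"
    by (rule sums_finite) (auto simp: binaryset_def)
  ultimately show ?thesis by (simp add: sums_unique2 binaryset_def)
qed

lemma smeasure_Diff:
  "A \<in> sets borel \<Longrightarrow> B \<in> sets borel \<Longrightarrow> B \<subseteq> A \<Longrightarrow> smeasure \<nu> (A - B) = smeasure \<nu> A - smeasure \<nu> B"
  using smeasure_Un[of B "A - B" \<nu>] by (simp add: Un_absorb1)

text \<open>If the values on subsets of \<open>A\<close> are unbounded, then they are unbounded on some \<open>B \<subseteq> A\<close>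
  with \<open>|\<nu>(A - B)| \<ge> 1\<close>. Iterating gives infinitely many disjoint sets of size at least 1.\<close>

lemma smeasure_bounded:
  fixes \<nu> :: "'a::topological_space signed_measure"
  shows "\<exists>M. \<forall>A. \<bar>smeasure \<nu> A\<bar> \<le> M"
proof (rule ccontr)
  define unb where "unb A \<longleftrightarrow> A \<in> sets borel \<and> (\<forall>M. \<exists>B\<in>sets borel. B \<subseteq> A \<and> M < \<bar>smeasure \<nu> B\<bar>)" for A
  assume contr: "\<nexists>M. \<forall>A. \<bar>smeasure \<nu> A\<bar> \<le> M"
  have U: "unb UNIV"
    unfolding unb_def
  proof (intro conjI allI)
    fix M
    obtain A where "M < \<bar>smeasure \<nu> A\<bar>" "0 < \<bar>smeasure \<nu> A\<bar>"
      using contr by (metis abs_ge_zero abs_zero linorder_not_le order_trans nle_le)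
    then show "\<exists>B\<in>sets borel. B \<subseteq> UNIV \<and> M < \<bar>smeasure \<nu> B\<bar>"
      by (intro bexI[of _ A]) (auto intro: ccontr simp: smeasure_notin)
  qed simp
  have step: "\<exists>B. unb B \<and> B \<subseteq> A \<and> 1 \<le> \<bar>smeasure \<nu> (A - B)\<bar>" if A: "unb A" for A
  proof -
    have Ab: "A \<in> sets borel" using A by (simp add: unb_def)
    \<comment> \<open>The margin \<bar>\<nu>(A)\<bar> + 1 makes both \<open>C\<close> and
      \<open>A - C\<close> of size at least 1, so whichever of them inherits unboundedness, the
      discarded other one is large.\<close>
    obtain C where C: "C \<in> sets borel" "C \<subseteq> A" "\<bar>smeasure \<nu> A\<bar> + 1 < \<bar>smeasure \<nu> C\<bar>"
      using A by (auto simp: unb_def)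
    have D: "smeasure \<nu> (A - C) = smeasure \<nu> A - smeasure \<nu> C" using smeasure_Diff[OF Ab C(1,2)] .
    have "unb C \<or> unb (A - C)"
    proof (rule ccontr)
      assume *: "\<not> (unb C \<or> unb (A - C))"
      have bdd: "\<exists>M. \<forall>B\<in>sets borel. B \<subseteq> E \<longrightarrow> \<bar>smeasure \<nu> B\<bar> \<le> M"
        if "\<not> unb E" "E \<in> sets borel" for E
        using that by (simp add: unb_def not_less)
      obtain M1 where M1: "\<And>B. B \<in> sets borel \<Longrightarrow> B \<subseteq> C \<Longrightarrow> \<bar>smeasure \<nu> B\<bar> \<le> M1"
        using bdd[of C] * C(1) by blast
      obtain M2 where M2: "\<And>B. B \<in> sets borel \<Longrightarrow> B \<subseteq> A - C \<Longrightarrow> \<bar>smeasure \<nu> B\<bar> \<le> M2"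
        using bdd[of "A - C"] * C(1) Ab by blast
      obtain B where B: "B \<in> sets borel" "B \<subseteq> A" "M1 + M2 < \<bar>smeasure \<nu> B\<bar>"
        using A by (auto simp: unb_def)
      have "smeasure \<nu> B = smeasure \<nu> (B \<inter> C) + smeasure \<nu> (B - C)"
        using B C smeasure_Un[of "B \<inter> C" "B - C" \<nu>] by (simp add: Int_Diff_disjoint Int_Diff_Un)
      moreover have "\<bar>smeasure \<nu> (B \<inter> C)\<bar> \<le> M1" "\<bar>smeasure \<nu> (B - C)\<bar> \<le> M2"
        using B C by (auto intro!: M1 M2)
      ultimately show False using B(3) by linarith
    qed
    then show ?thesis
    proof
      assume "unb C"
      then show ?thesis using C D by (intro exI[of _ C]) auto
    next
      assume "unb (A - C)"
      moreover have "A - (A - C) = C" using C by auto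
      ultimately show ?thesis using C D by (intro exI[of _ "A - C"]) auto
    qed
  qed
  obtain S where S: "\<And>A. unb A \<Longrightarrow> unb (S A) \<and> S A \<subseteq> A \<and> 1 \<le> \<bar>smeasure \<nu> (A - S A)\<bar>"
    using step by metis
  define A where "A n = (S ^^ n) UNIV" for n
  have Au: "unb (A n)" for n
    by (induction n) (auto simp: A_def U S)
  have ASuc: "A (Suc n) = S (A n)" for n by (simp add: A_def)
  have Amono: "A n \<subseteq> A m" if "m \<le> n" for m n
    using lift_Suc_antimono_le[of A m n] S[OF Au] that by (simp add: ASuc)
  define D where "D n = A n - A (Suc n)" for n
  have "disjoint_family D"
    unfolding disjoint_family_on_def
  proof (intro ballI impI)
    fix m n :: nat assume "m \<noteq> n"
    then have "Suc m \<le> n \<or> Suc n \<le> m" by linarith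
    then show "D m \<inter> D n = {}" using Amono[of "Suc m" n] Amono[of "Suc n" m] by (auto simp: D_def)
  qed
  moreover have "D n \<in> sets borel" for n using Au by (auto simp: D_def unb_def)
  ultimately have "(\<lambda>n. smeasure \<nu> (D n)) \<longlonglongrightarrow> 0"
    using smeasure_sums[of D \<nu>] by (intro summable_LIMSEQ_zero) (auto intro: sums_summable)
  then obtain n where "\<bar>smeasure \<nu> (D n)\<bar> < 1" 
    using LIMSEQ_D[of "\<lambda>n. smeasure \<nu> (D n)" 0 1] by auto
  then show False using S[OF Au, of n] by (simp add: D_def ASuc)
qed

text \<open>The set function underlying \<open>pos_part_measure\<close>. \<open>measure_of\<close>
  yields the zero measure unless its argument is a measure, so additivity has to be proved for the
  bare function first.\<close>

definition pos_part :: "'a::topological_space signed_measure \<Rightarrow> 'a set \<Rightarrow> ennreal" where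
  "pos_part \<nu> A = (SUP B\<in>{B \<in> sets borel. B \<subseteq> A}. ennreal (smeasure \<nu> B))"

lemma le_pos_part: "B \<in> sets borel \<Longrightarrow> B \<subseteq> A \<Longrightarrow> ennreal (smeasure \<nu> B) \<le> pos_part \<nu> A"
  unfolding pos_part_def by (rule SUP_upper) simp

lemma pos_part_mono: "A \<subseteq> B \<Longrightarrow> pos_part \<nu> A \<le> pos_part \<nu> B"
  unfolding pos_part_def by (rule SUP_subset_mono) auto

lemma pos_part_empty: "pos_part \<nu> {} = 0"
proof -
  have "{B \<in> sets borel. B \<subseteq> {}} = {{}}" by auto
  then show ?thesis by (simp add: pos_part_def)
qed

lemma pos_part_finite: "pos_part \<nu> A < top"
proof -
  obtain M where M: "\<And>A. \<bar>smeasure \<nu> A\<bar> \<le> M" using smeasure_bounded by blast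
  have "pos_part \<nu> A \<le> ennreal M"
    unfolding pos_part_def using M by (intro SUP_least ennreal_leI) (auto intro: abs_le_D1)
  then show ?thesis by (rule le_less_trans) simp
qed

lemma pos_part_superadditive:
  assumes "A \<inter> B = {}"
  shows "pos_part \<nu> A + pos_part \<nu> B \<le> pos_part \<nu> (A \<union> B)"
proof -
  have *: "ennreal (smeasure \<nu> C) + ennreal (smeasure \<nu> D) \<le> pos_part \<nu> (A \<union> B)"
    if C: "C \<in> sets borel" "C \<subseteq> A" and D: "D \<in> sets borel" "D \<subseteq> B" for C D
  proof (cases "0 \<le> smeasure \<nu> C \<and> 0 \<le> smeasure \<nu> D")
    case True
    have "smeasure \<nu> (C \<union> D) = smeasure \<nu> C + smeasure \<nu> D"
      using that assms by (intro smeasure_Un) auto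
    then show ?thesis
      using True le_pos_part[of "C \<union> D" "A \<union> B" \<nu>] that by (simp add: le_supI1 le_supI2 flip: ennreal_plus)
  next
    case False
    then show ?thesis
      using le_pos_part[of C "A \<union> B" \<nu>] le_pos_part[of D "A \<union> B" \<nu>] that
      by (auto simp: ennreal_neg le_supI1 le_supI2)
  qed
  have "pos_part \<nu> B + ennreal (smeasure \<nu> C) \<le> pos_part \<nu> (A \<union> B)"
    if C: "C \<in> sets borel" "C \<subseteq> A" for C
    unfolding pos_part_def[of \<nu> B]
    by (subst ennreal_SUP_add_left[symmetric]) (use *[OF C] in \<open>auto intro!: SUP_least simp: add.commute\<close>)
  then show ?thesis
    unfolding pos_part_def[of \<nu> A]
    by (subst ennreal_SUP_add_left[symmetric]) (auto intro!: SUP_least simp: add.commute)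
qed

text \<open>One inequality is finite superadditivity passed to the limit. For the other, a Borel
  subset \<open>B\<close> of the union is cut into the pieces \<open>B \<inter> A i\<close>, over
  which \<nu> is countably additive.\<close>

lemma measure_space_pos_part: "measure_space UNIV (sets borel) (pos_part \<nu>)"
  unfolding measure_space_def
proof (intro conjI)
  show "positive (sets borel) (pos_part \<nu>)"
    by (simp add: positive_def pos_part_empty)
  show "countably_additive (sets borel) (pos_part \<nu>)"
    unfolding countably_additive_def
  proof (intro allI impI antisym)
    fix A :: "nat \<Rightarrow> 'a set" assume A: "range A \<subseteq> sets borel" and dis: "disjoint_family A"
    have fin: "(\<Sum>i<n. pos_part \<nu> (A i)) \<le> pos_part \<nu> (\<Union>i<n. A i)" for n
    proof (induction n)
      case (Suc n)
      have "A i \<inter> A n = {}" if "i < n" for i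
        using disjoint_family_onD[OF dis, of i n] that by simp
      then have "(\<Union>i<n. A i) \<inter> A n = {}" by blast
      then have "pos_part \<nu> (\<Union>i<n. A i) + pos_part \<nu> (A n) \<le> pos_part \<nu> ((\<Union>i<n. A i) \<union> A n)"
        by (rule pos_part_superadditive)
      then show ?case
        using order_trans[OF add_right_mono[OF Suc, of "pos_part \<nu> (A n)"]]
        by (simp add: lessThan_Suc Un_commute add.commute[of "pos_part \<nu> (A n)"])
    qed (simp add: pos_part_empty)
    show "(\<Sum>i. pos_part \<nu> (A i)) \<le> pos_part \<nu> (\<Union>i. A i)"
      by (intro suminf_le_const[OF summableI] order_trans[OF fin] pos_part_mono) auto
    show "pos_part \<nu> (\<Union>i. A i) \<le> (\<Sum>i. pos_part \<nu> (A i))"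
      unfolding pos_part_def[of \<nu> "\<Union>i. A i"]
    proof (rule SUP_least, clarify)
      fix B assume B: "B \<in> sets borel" "B \<subseteq> (\<Union>i. A i)"
      have "disjoint_family (\<lambda>i. B \<inter> A i)"
        by (rule disjoint_family_subset[OF dis]) auto
      then have "(\<lambda>i. smeasure \<nu> (B \<inter> A i)) sums smeasure \<nu> (\<Union>i. B \<inter> A i)"
        using A B by (intro smeasure_sums) auto
      moreover have "(\<Union>i. B \<inter> A i) = B" using B by auto
      ultimately have "(\<lambda>n. \<Sum>i<n. smeasure \<nu> (B \<inter> A i)) \<longlonglongrightarrow> smeasure \<nu> B"
        by (simp add: sums_def)
      then have lim: "(\<lambda>n. ennreal (\<Sum>i<n. smeasure \<nu> (B \<inter> A i))) \<longlonglongrightarrow> ennreal (smeasure \<nu> B)"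
        by (rule tendsto_ennrealI)
      have sum_le: "ennreal (sum g I) \<le> (\<Sum>i\<in>I. ennreal (g i))" if "finite I" for g and I :: "nat set"
        using that
      proof (induction I rule: finite_induct)
        case (insert i I)
        have "ennreal (g i + sum g I) \<le> ennreal (g i) + ennreal (sum g I)"
          by (cases "0 \<le> g i"; cases "0 \<le> sum g I") (auto simp: ennreal_neg intro: ennreal_leI simp flip: ennreal_plus)
        then show ?case using insert by (auto intro: order_trans add_left_mono)
      qed simp
      have "ennreal (\<Sum>i<n. smeasure \<nu> (B \<inter> A i)) \<le> (\<Sum>i. pos_part \<nu> (A i))" for n
      proof -
        have "ennreal (\<Sum>i<n. smeasure \<nu> (B \<inter> A i)) \<le> (\<Sum>i<n. ennreal (smeasure \<nu> (B \<inter> A i)))"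
          by (rule sum_le) simp
        also have "\<dots> \<le> (\<Sum>i<n. pos_part \<nu> (A i))"
          using A B by (intro sum_mono le_pos_part) auto
        also have "\<dots> \<le> (\<Sum>i. pos_part \<nu> (A i))" by (intro sum_le_suminf) auto
        finally show ?thesis .
      qed
      then show "ennreal (smeasure \<nu> B) \<le> (\<Sum>i. pos_part \<nu> (A i))"
        by (intro LIMSEQ_le_const2[OF lim]) auto
    qed
  qed
qed (metis sets.sigma_algebra_axioms space_borel)

lemma
  shows sets_pos_part_measure [simp, measurable_cong]: "sets (pos_part_measure \<nu>) = sets borel"
    and space_pos_part_measure [simp]: "space (pos_part_measure \<nu>) = UNIV"
  by (simp_all add: pos_part_measure_def sets.sigma_sets_eq[of borel, simplified])

lemma emeasure_pos_part_measure:
  "A \<in> sets borel \<Longrightarrow> emeasure (pos_part_measure \<nu>) A = pos_part \<nu> A"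
  using measure_space_pos_part[of \<nu>] unfolding pos_part_measure_def pos_part_def[symmetric]
  by (intro emeasure_measure_of_sigma) (auto simp: measure_space_def)

lemma finite_pos_part_measure: "finite_measure (pos_part_measure \<nu>)"
  using pos_part_finite[of \<nu> UNIV] by (intro finite_measureI) (simp add: emeasure_pos_part_measure)

text \<open>No Hahn decomposition is involved: \<nu>(B) = \<nu>(A) - \<nu>(A - B) <= \<nu>(A) +
  \<nu>^-(A) for Borel B inside A, and the supremum over B gives one inequality. The same inequality
  for -\<nu> is the other.\<close>

lemma Jordan_decomposition:
  assumes A: "A \<in> sets borel"
  shows "smeasure \<nu> A = measure (pos_part_measure \<nu>) A - measure (pos_part_measure (- \<nu>)) A"
proof -
  have le: "measure (pos_part_measure \<nu>) A \<le> smeasure \<nu> A + measure (pos_part_measure (- \<nu>)) A"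
    for \<nu> :: "'a signed_measure"
  proof -
    interpret N: finite_measure "pos_part_measure (- \<nu>)" by (rule finite_pos_part_measure)
    interpret P: finite_measure "pos_part_measure \<nu>" by (rule finite_pos_part_measure)
    have *: "smeasure \<nu> B \<le> smeasure \<nu> A + measure (pos_part_measure (- \<nu>)) A"
      if B: "B \<in> sets borel" "B \<subseteq> A" for B
    proof -
      have "ennreal (smeasure (- \<nu>) (A - B)) \<le> ennreal (measure (pos_part_measure (- \<nu>)) A)"
        unfolding N.emeasure_eq_measure[symmetric] emeasure_pos_part_measure[OF A]
        using A B by (intro le_pos_part) auto
      then have "smeasure (- \<nu>) (A - B) \<le> measure (pos_part_measure (- \<nu>)) A" by simp
      then show ?thesis using smeasure_Diff[OF A B, of \<nu>] by (simp add: uminus_signed_measure.rep_eq)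
    qed
    have "ennreal (measure (pos_part_measure \<nu>) A)
        \<le> ennreal (smeasure \<nu> A + measure (pos_part_measure (- \<nu>)) A)"
      unfolding P.emeasure_eq_measure[symmetric] emeasure_pos_part_measure[OF A] pos_part_def
      using * by (intro SUP_least ennreal_leI) auto
    then show ?thesis using *[of "{}"] by simp
  qed
  show ?thesis using le[of \<nu>] le[of "- \<nu>"] by (simp add: uminus_signed_measure.rep_eq)
qed

text \<open>Lipschitz functions converge boundedly to the indicator of a closed set, and dominated
  convergence for both finite Jordan parts identifies \<nu> there. Closed sets are stable under
  intersection and generate the Borel sets, so agreement spreads to all of them.\<close>

theorem signed_measure_eqI:
  fixes \<nu> :: "'a::metric_space signed_measure"
  assumes \<sigma>: "\<sigma> \<in> prob_measures"
    and eq: "\<And>f :: 'a \<Rightarrow>\<^sub>C real. signed_integral \<nu> (apply_bcontfun f) = (\<integral>x. apply_bcontfun f x \<partial>\<sigma>)"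
  shows "\<nu> = signed_of \<sigma>"
proof -
  have ps: "prob_space \<sigma>" and sets [measurable_cong]: "sets \<sigma> = sets borel"
    using \<sigma> by (auto simp: prob_measures_def)
  interpret prob_space \<sigma> by fact
  have space: "space \<sigma> = UNIV" using sets_eq_imp_space_eq[OF sets] by simp
  have closed: "smeasure \<nu> F = measure \<sigma> F" if F: "closed F" for F
  \<comment> \<open>For empty \<open>F\<close> the convention \<open>infdist x {} = 0\<close> would
    make every \<open>h n\<close> constantly 1.\<close>
  proof (cases "F = {}")
    case False
    define h where "h n x = max 0 (1 - real n * infdist x F)" for n x
    have hc: "continuous_on UNIV (h n)" for n
      unfolding h_def by (intro continuous_intros)
    have hb: "\<bar>h n x\<bar> \<le> 1" for n x by (auto simp: h_def infdist_nonneg)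
    have ap: "apply_bcontfun (Bcontfun (h n)) = h n" for n
      using hc hb by (intro Bcontfun_inverse bcontfun_normI[of _ 1]) auto
    have lim: "(\<lambda>n. h n x) \<longlonglongrightarrow> indicator F x" for x
    proof (cases "x \<in> F")
      case True
      then show ?thesis by (simp add: h_def)
    next
      case x: False
      then have pos: "0 < infdist x F" using infdist_pos_not_in_closed[OF F False] by simp
      obtain N :: nat where N: "1 / infdist x F \<le> real N" using real_arch_simple by blast
      have "h n x = 0" if "N \<le> n" for n
      proof -
        have "1 \<le> real N * infdist x F" using N pos by (simp add: field_simps)
        also have "\<dots> \<le> real n * infdist x F" using that pos by (intro mult_right_mono) auto
        finally show ?thesis by (simp add: h_def)
      qed
      then have "eventually (\<lambda>n. h n x = 0) sequentially" by (auto simp: eventually_sequentially)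
      then show ?thesis using x by (simp add: tendsto_eventually)
    qed
    have int_lim: "(\<lambda>n. \<integral>x. h n x \<partial>M) \<longlonglongrightarrow> measure M F"
      if M: "finite_measure M" "sets M = sets borel" for M
    proof -
      interpret M: finite_measure M by fact
      have "space M = UNIV" using sets_eq_imp_space_eq[OF M(2)] by simp
      note [measurable_cong] = M(2)
      have [measurable]: "h n \<in> borel_measurable borel" for n
        by (rule borel_measurable_continuous_onI[OF hc])
      have [measurable]: "F \<in> sets borel" using F by simp
      have "(\<lambda>n. \<integral>x. h n x \<partial>M) \<longlonglongrightarrow> (\<integral>x. indicator F x \<partial>M)"
        using hb lim by (intro integral_dominated_convergence[where w="\<lambda>_. 1"]) auto
      then show ?thesis by (simp add: M(2) \<open>space M = UNIV\<close>)
    qed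
    have "(\<lambda>n. signed_integral \<nu> (h n))
        \<longlonglongrightarrow> measure (pos_part_measure \<nu>) F - measure (pos_part_measure (- \<nu>)) F"
      unfolding signed_integral_def by (intro tendsto_diff int_lim finite_pos_part_measure) simp_all
    moreover have "(\<lambda>n. signed_integral \<nu> (h n)) \<longlonglongrightarrow> measure \<sigma> F"
      using int_lim[of \<sigma>] eq[of "Bcontfun (h _)"] by (simp add: ap sets finite_measure_axioms)
    ultimately show ?thesis
      using Jordan_decomposition[of F \<nu>] F by (simp add: LIMSEQ_unique)
  qed simp
  have "smeasure \<nu> A = measure \<sigma> A" if "A \<in> sigma_sets UNIV {F. closed F}" for A
  proof (rule sigma_sets_induct_disjoint[OF _ _ that])
    show "Int_stable {F. closed (F :: 'a set)}" by (auto simp: Int_stable_def)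
  next
    have bor: "sigma_sets UNIV {F. closed (F :: 'a set)} = sets borel"
      by (simp add: borel_eq_closed)
    show "smeasure \<nu> (UNIV - A) = measure \<sigma> (UNIV - A)"
      if "A \<in> sigma_sets UNIV {F. closed F}" "smeasure \<nu> A = measure \<sigma> A" for A
      using that closed[of UNIV] smeasure_Diff[of UNIV A \<nu>] prob_compl[of A] prob_space
      by (simp add: bor sets space)
    show "smeasure \<nu> (\<Union>i. A i) = measure \<sigma> (\<Union>i. A i)"
      if "disjoint_family A" "range A \<subseteq> sigma_sets UNIV {F. closed F}"
        "\<And>i. smeasure \<nu> (A i) = measure \<sigma> (A i)" for A :: "nat \<Rightarrow> 'a set"
      using that smeasure_sums[of A \<nu>] finite_measure_UNION[of A]
      by (simp add: bor sets) (metis sums_unique2)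
  qed (auto intro: closed)
  then have "smeasure \<nu> A = measure \<sigma> A" if "A \<in> sets borel" for A
    using that by (simp add: borel_eq_closed)
  moreover have "smeasure \<nu> A = measure \<sigma> A" if "A \<notin> sets borel" for A
    using that by (simp add: smeasure_notin measure_notin_sets sets)
  ultimately have "smeasure \<nu> = smeasure (signed_of \<sigma>)"
    by (subst smeasure_signed_of) (auto simp: sets finite_measure_axioms)
  then show ?thesis by (simp add: smeasure_inject)
qed

subsection \<open>The weak* topology on probability measures\<close>

lemma integrable_bcontfun:
  fixes g :: "'a::metric_space \<Rightarrow>\<^sub>C real"
  assumes "\<sigma> \<in> prob_measures"
  shows "integrable \<sigma> (apply_bcontfun g)"
proof -
  interpret prob_space \<sigma> using prob_measuresD[OF assms] by simp
  note [measurable_cong] = prob_measuresD(2)[OF assms]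
  have [measurable]: "apply_bcontfun g \<in> borel_measurable borel"
    by (intro borel_measurable_continuous_onI) simp
  show ?thesis
    by (rule integrable_const_bound[of _ "norm g"]) (use norm_bounded[of g] in auto)
qed

lemma signed_integral_prob:
  "\<sigma> \<in> prob_measures \<Longrightarrow> signed_integral (signed_of \<sigma>) f = (\<integral>x. f x \<partial>\<sigma>)"
  by (intro signed_integral_signed_of) (auto simp: prob_measures_def prob_space_def)

lemma inj_on_signed_of: "inj_on signed_of prob_measures"
proof (rule inj_onI)
  fix \<mu> \<nu> :: "'a measure" assume \<mu>: "\<mu> \<in> prob_measures" and \<nu>: "\<nu> \<in> prob_measures"
    and eq: "signed_of \<mu> = signed_of \<nu>"
  interpret M: prob_space \<mu> using prob_measuresD[OF \<mu>] by simp
  interpret N: prob_space \<nu> using prob_measuresD[OF \<nu>] by simp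
  have "measure \<mu> = measure \<nu>"
    using arg_cong[OF eq, of smeasure] prob_measuresD(2)[OF \<mu>] prob_measuresD(2)[OF \<nu>]
    by (simp add: smeasure_signed_of M.finite_measure_axioms N.finite_measure_axioms)
  then show "\<mu> = \<nu>"
    using prob_measuresD(2)[OF \<mu>] prob_measuresD(2)[OF \<nu>]
    by (intro measure_eqI) (auto simp: M.emeasure_eq_measure N.emeasure_eq_measure)
qed

lemma continuous_signed_integral:
  "continuous_on UNIV (\<lambda>\<nu>. signed_integral \<nu> (apply_bcontfun f))"
  unfolding continuous_on_open_vimage[OF open_UNIV]
proof (intro allI impI)
  fix U :: "real set" assume "open U"
  then show "open ((\<lambda>\<nu>. signed_integral \<nu> (apply_bcontfun f)) -` U \<inter> UNIV)"
    unfolding open_signed_measure_def vimage_def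
    by (simp, intro generate_topology.Basis) blast
qed

text \<open>Universal property of the initial topology: continuity is tested on the generating
  functionals.\<close>

lemma continuous_on_signed_measureI:
  fixes f :: "'a::topological_space \<Rightarrow> 'b::topological_space signed_measure"
  assumes "\<And>g. continuous_on A (\<lambda>x. signed_integral (f x) (apply_bcontfun g))"
  shows "continuous_on A f"
proof (rule continuous_on_generate_topology[OF open_signed_measure_def])
  fix B assume "B \<in> {{\<nu>. signed_integral \<nu> (apply_bcontfun f) \<in> U} | (f :: 'b \<Rightarrow>\<^sub>C real) U. open U}"
  then obtain g :: "'b \<Rightarrow>\<^sub>C real" and U where B: "B = {\<nu>. signed_integral \<nu> (apply_bcontfun g) \<in> U}" "open U"
    by blast
  then show "\<exists>C. open C \<and> C \<inter> A = f -` B \<inter> A"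
    using assms[of g, unfolded continuous_on_open_invariant] by (auto simp: vimage_def)
qed

section \<open>Probability measures as positive normalized functionals: closedness and
  compactness\<close>

text \<open>The state space of C(X), kept as a subset of the product space of all real functions on
  C(X). The product topology is pointwise convergence, matching weak* convergence, and makes
  Tychonoff's theorem applicable.\<close>

definition positive_normalized :: "(('a::metric_space \<Rightarrow>\<^sub>C real) \<Rightarrow> real) set" where
  "positive_normalized = {l. (\<forall>g h. l (g + h) = l g + l h) \<and> (\<forall>c g. l (c *\<^sub>R g) = c * l g) \<and>
     (\<forall>g. (\<forall>y. 0 \<le> apply_bcontfun g y) \<longrightarrow> 0 \<le> l g) \<and> l (const_bcontfun 1) = 1}"

lemma closed_positive_normalized: "closed positive_normalized"
  unfolding positive_normalized_def
  by (intro closed_Collect_conj closed_Collect_all closed_Collect_imp closed_Collect_eq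
      closed_Collect_le open_Collect_const continuous_intros) auto

lemma integral_positive_normalized:
  assumes \<sigma>: "\<sigma> \<in> prob_measures"
  shows "(\<lambda>g. \<integral>x. apply_bcontfun g x \<partial>\<sigma>) \<in> positive_normalized"
proof -
  interpret prob_space \<sigma> using prob_measuresD[OF \<sigma>] by simp
  show ?thesis
    using integrable_bcontfun[OF \<sigma>] prob_space
    by (auto simp: positive_normalized_def const_bcontfun.rep_eq)
qed

lemma Riesz_positive_normalized:
  fixes l :: "('a::metric_space \<Rightarrow>\<^sub>C real) \<Rightarrow> real"
  assumes "compact (UNIV :: 'a set)" "l \<in> positive_normalized"
  shows "\<exists>\<sigma>\<in>prob_measures. \<forall>g. l g = (\<integral>y. apply_bcontfun g y \<partial>\<sigma>)"
  using assms by (intro Riesz_representation) (auto simp: positive_normalized_def)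

text \<open>Being a probability measure becomes a condition on integrals against continuous
  functions. Those depend continuously on \<nu>, so the set of probability measures is the preimage
  of a closed set.\<close>

lemma signed_prob_measures_iff:
  fixes \<nu> :: "'a::metric_space signed_measure"
  assumes "compact (UNIV :: 'a set)"
  shows "\<nu> \<in> signed_of ` prob_measures \<longleftrightarrow>
    (\<lambda>g. signed_integral \<nu> (apply_bcontfun g)) \<in> positive_normalized"
proof
  assume "\<nu> \<in> signed_of ` prob_measures"
  then show "(\<lambda>g. signed_integral \<nu> (apply_bcontfun g)) \<in> positive_normalized"
    using integral_positive_normalized by (auto simp: signed_integral_prob)
next
  assume "(\<lambda>g. signed_integral \<nu> (apply_bcontfun g)) \<in> positive_normalized"
  from Riesz_positive_normalized[OF assms this] obtain \<sigma> where \<sigma>: "\<sigma> \<in> prob_measures"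
    "\<And>g. signed_integral \<nu> (apply_bcontfun g) = (\<integral>y. apply_bcontfun g y \<partial>\<sigma>)" by blast
  then show "\<nu> \<in> signed_of ` prob_measures" using signed_measure_eqI[OF \<sigma>] by blast
qed

lemma closed_signed_prob_measures:
  assumes "compact (UNIV :: 'a::metric_space set)"
  shows "closed (signed_of ` prob_measures :: 'a signed_measure set)"
proof -
  have "continuous_on UNIV (\<lambda>(\<nu> :: 'a signed_measure) g. signed_integral \<nu> (apply_bcontfun g))"
    by (intro continuous_on_coordinatewise_then_product continuous_signed_integral)
  from closed_vimage[OF closed_positive_normalized this]
  have "closed ((\<lambda>(\<nu> :: 'a signed_measure) g. signed_integral \<nu> (apply_bcontfun g)) -` positive_normalized)"
    by simp
  also have "(\<lambda>(\<nu> :: 'a signed_measure) g. signed_integral \<nu> (apply_bcontfun g)) -` positive_normalized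
      = signed_of ` prob_measures"
    using signed_prob_measures_iff[OF assms] by blast
  finally show ?thesis .
qed

text \<open>The Banach-Alaoglu argument: positivity on norm(g) - g and norm(g) + g gives
  \<bar>l(g)\<bar> <= norm(g), so the set is closed inside a product of compact intervals.\<close>

lemma compact_positive_normalized: "compact (positive_normalized :: (('a::metric_space \<Rightarrow>\<^sub>C real) \<Rightarrow> real) set)"
proof -
  have bound: "l g \<le> norm g" if l: "l \<in> positive_normalized" for l and g :: "'a \<Rightarrow>\<^sub>C real"
  proof -
    have "0 \<le> l (norm g *\<^sub>R const_bcontfun 1 + (- 1) *\<^sub>R g)"
      using l norm_bounded[of g] by (auto simp: positive_normalized_def const_bcontfun.rep_eq abs_le_iff)
    moreover have "l (norm g *\<^sub>R const_bcontfun 1 + (- 1) *\<^sub>R g) = norm g * 1 + - 1 * l g"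
      using l unfolding positive_normalized_def by (simp only: mem_Collect_eq)
    ultimately show ?thesis by simp
  qed
  have "positive_normalized \<subseteq> (\<Pi>\<^sub>E g\<in>UNIV. {- norm g..norm (g :: 'a \<Rightarrow>\<^sub>C real)})"
  proof (clarsimp simp: PiE_UNIV_domain)
    fix l :: "('a \<Rightarrow>\<^sub>C real) \<Rightarrow> real" and g assume l: "l \<in> positive_normalized"
    have "l ((- 1) *\<^sub>R g) = - 1 * l g"
      using l unfolding positive_normalized_def by (simp only: mem_Collect_eq)
    then show "- norm g \<le> l g \<and> l g \<le> norm g"
      using bound[OF l, of g] bound[OF l, of "(- 1) *\<^sub>R g"] by simp
  qed
  moreover have "compact (\<Pi>\<^sub>E g\<in>UNIV. {- norm g..norm (g :: 'a \<Rightarrow>\<^sub>C real)})"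
    unfolding compactin_euclidean_iff[symmetric] euclidean_product_topology[symmetric] compactin_PiE
    by simp
  ultimately show ?thesis
    using closed_positive_normalized by (metis compact_Int_closed inf.absorb2)
qed

text \<open>The probability measures are the image of the compact set of functionals under a choice
  \<open>R\<close> of representing measures. This map is continuous because integrating
  \<open>g\<close> against \<open>R l\<close> just reads off the coordinate
  \<open>l g\<close>.\<close>

lemma compact_signed_prob_measures:
  assumes compact: "compact (UNIV :: 'a::metric_space set)"
  shows "compact (signed_of ` prob_measures :: 'a signed_measure set)"
proof -
  obtain R :: "(('a \<Rightarrow>\<^sub>C real) \<Rightarrow> real) \<Rightarrow> 'a measure" where
    R: "\<And>l. l \<in> positive_normalized \<Longrightarrow> R l \<in> prob_measures"
    "\<And>l g. l \<in> positive_normalized \<Longrightarrow> l g = (\<integral>y. apply_bcontfun g y \<partial>R l)"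
    using Riesz_positive_normalized[OF compact] by metis
  have "continuous_on positive_normalized (\<lambda>l. signed_of (R l))"
  proof (rule continuous_on_signed_measureI)
    fix g :: "'a \<Rightarrow>\<^sub>C real"
    have "continuous_on positive_normalized (\<lambda>l :: ('a \<Rightarrow>\<^sub>C real) \<Rightarrow> real. l g)"
      by (rule continuous_on_subset[OF continuous_on_product_coordinates]) simp
    then show "continuous_on positive_normalized (\<lambda>l. signed_integral (signed_of (R l)) (apply_bcontfun g))"
      by (rule continuous_on_cong[THEN iffD1, rotated -1]) (auto simp: signed_integral_prob R(1) R(2)[symmetric])
  qed
  then have "compact ((\<lambda>l. signed_of (R l)) ` positive_normalized)"
    by (rule compact_continuous_image) (rule compact_positive_normalized)
  also have "(\<lambda>l. signed_of (R l)) ` positive_normalized = signed_of ` prob_measures"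
  proof
    show "signed_of ` prob_measures \<subseteq> (\<lambda>l. signed_of (R l)) ` positive_normalized"
    proof clarify
      fix \<sigma> :: "'a measure" assume \<sigma>: "\<sigma> \<in> prob_measures"
      let ?l = "\<lambda>g. \<integral>y. apply_bcontfun g y \<partial>\<sigma>"
      have l: "?l \<in> positive_normalized" by (rule integral_positive_normalized[OF \<sigma>])
      have "signed_of \<sigma> = signed_of (R ?l)"
        by (rule signed_measure_eqI[OF R(1)[OF l]]) (simp add: signed_integral_prob[OF \<sigma>] R(2)[OF l, symmetric])
      then show "signed_of \<sigma> \<in> (\<lambda>l. signed_of (R l)) ` positive_normalized" using l by blast
    qed
  qed (use R(1) in blast)
  finally show ?thesis .
qed

lemma continuous_signed_of_return:
  "continuous_on UNIV (\<lambda>x :: 'a::metric_space. signed_of (return borel x))"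
proof (rule continuous_on_signed_measureI)
  fix g :: "'a \<Rightarrow>\<^sub>C real"
  have "apply_bcontfun g \<in> borel_measurable borel"
    by (intro borel_measurable_continuous_onI) simp
  then have "signed_integral (signed_of (return borel x)) (apply_bcontfun g) = apply_bcontfun g x" for x
    by (simp add: signed_integral_prob return_in_prob_measures integral_return)
  then show "continuous_on UNIV (\<lambda>x. signed_integral (signed_of (return borel x)) (apply_bcontfun g))"
    by simp
qed

lemma ereal_integral_bcontfun:
  fixes g :: "'a::metric_space \<Rightarrow>\<^sub>C real"
  assumes "\<mu> \<in> prob_measures"
  shows "ereal_integral \<mu> (\<lambda>x. ereal (apply_bcontfun g x)) = ereal (\<integral>x. apply_bcontfun g x \<partial>\<mu>)"
  using norm_bounded[of g]
  by (intro ereal_integral_ereal[OF assms, where B="norm g"] borel_measurable_continuous_onI) auto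

lemma bcontfun_bounded_above_borel:
  fixes g :: "'a::metric_space \<Rightarrow>\<^sub>C real"
  shows "(\<lambda>x. ereal (apply_bcontfun g x)) \<in> bounded_above_borel"
proof -
  have [measurable]: "apply_bcontfun g \<in> borel_measurable borel"
    by (intro borel_measurable_continuous_onI) simp
  show ?thesis
    using norm_bounded[of g] by (auto simp: bounded_above_borel_def bounded_above_def abs_le_iff intro!: exI[of _ "norm g"])
qed

text \<open>The mixture is realized by drawing one of the two measures with a Bernoulli variable.
  Its construction as an actual measure is what connects vector operations on signed measures with
  integrals of functions that may be -infinity.\<close>

lemma mixture:
  fixes \<mu> \<nu> :: "'a::metric_space measure"
  assumes \<mu>: "\<mu> \<in> prob_measures" and \<nu>: "\<nu> \<in> prob_measures" and t: "0 < t" "t < 1"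
  shows "\<exists>\<rho>\<in>prob_measures. signed_of \<rho> = t *\<^sub>R signed_of \<mu> + (1 - t) *\<^sub>R signed_of \<nu> \<and>
    (\<forall>f\<in>bounded_above_borel. ereal_integral \<rho> f
      = ereal t * ereal_integral \<mu> f + ereal (1 - t) * ereal_integral \<nu> f) \<and>
    (\<forall>g :: 'a \<Rightarrow>\<^sub>C real. (\<integral>x. apply_bcontfun g x \<partial>\<rho>)
      = t * (\<integral>x. apply_bcontfun g x \<partial>\<mu>) + (1 - t) * (\<integral>x. apply_bcontfun g x \<partial>\<nu>))"
proof -
  interpret M: prob_space \<mu> using prob_measuresD[OF \<mu>] by simp
  interpret N: prob_space \<nu> using prob_measuresD[OF \<nu>] by simp
  note sets = prob_measuresD(2)[OF \<mu>] prob_measuresD(2)[OF \<nu>]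
  note [measurable_cong] = sets
  define K where "K b = (if b then \<mu> else \<nu>)" for b
  define \<rho> where "\<rho> = measure_pmf (bernoulli_pmf t) \<bind> K"
  have K: "K \<in> measurable (measure_pmf (bernoulli_pmf t)) (subprob_algebra borel)"
    by (auto simp: K_def space_subprob_algebra sets M.subprob_space_axioms N.subprob_space_axioms)
  have sets_rho [measurable_cong]: "sets \<rho> = sets borel"
    unfolding \<rho>_def by (rule sets_bind[of _ _ borel]) (auto simp: K_def sets)
  have nn: "(\<integral>\<^sup>+x. f x \<partial>\<rho>) = ennreal t * (\<integral>\<^sup>+x. f x \<partial>\<mu>) + ennreal (1 - t) * (\<integral>\<^sup>+x. f x \<partial>\<nu>)"
    if "f \<in> borel_measurable borel" for f
    unfolding \<rho>_def nn_integral_bind[OF that K] using t by (simp add: K_def mult.commute)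
  have em: "emeasure \<rho> A = ennreal t * emeasure \<mu> A + ennreal (1 - t) * emeasure \<nu> A"
    if "A \<in> sets borel" for A
    using nn[of "indicator A"] that by (simp add: sets sets_rho)
  have "emeasure \<rho> (space \<rho>) = 1"
    using em[of UNIV] t M.emeasure_space_1 N.emeasure_space_1 prob_measuresD(3)[OF \<mu>] prob_measuresD(3)[OF \<nu>]
      sets_eq_imp_space_eq[OF sets_rho] by (simp flip: ennreal_plus)
  then interpret R: prob_space \<rho> by (rule prob_spaceI)
  have \<rho>: "\<rho> \<in> prob_measures"
    by (simp add: prob_measures_def sets_rho R.prob_space_axioms)
  have "measure \<rho> A = t * measure \<mu> A + (1 - t) * measure \<nu> A" for A
  proof (cases "A \<in> sets borel")
    case True
    then have "ennreal (measure \<rho> A) = ennreal (t * measure \<mu> A + (1 - t) * measure \<nu> A)"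
      using em[OF True] t
      by (simp add: R.emeasure_eq_measure M.emeasure_eq_measure N.emeasure_eq_measure ennreal_mult)
    then show ?thesis using t by (subst (asm) ennreal_inj) (auto simp: measure_nonneg)
  qed (simp add: measure_notin_sets sets sets_rho)
  then have "signed_of \<rho> = t *\<^sub>R signed_of \<mu> + (1 - t) *\<^sub>R signed_of \<nu>"
    by (simp add: smeasure_inject[symmetric] fun_eq_iff plus_signed_measure.rep_eq scaleR_signed_measure.rep_eq
        smeasure_signed_of sets sets_rho R.finite_measure_axioms M.finite_measure_axioms N.finite_measure_axioms)
  moreover have EI: "ereal_integral \<rho> f = ereal t * ereal_integral \<mu> f + ereal (1 - t) * ereal_integral \<nu> f"
    if "f \<in> bounded_above_borel" for f
  proof -
    have fm [measurable]: "f \<in> borel_measurable borel" and "bounded_above f"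
      using that by (auto simp: bounded_above_borel_def)
    from \<open>bounded_above f\<close> obtain C where C: "0 \<le> C" "\<And>x. f x \<le> ereal C"
      by (rule bounded_aboveE[where B=0]) auto
    show ?thesis
      unfolding ereal_integral_eq[OF \<rho> fm C(2,1)] ereal_integral_eq[OF \<mu> fm C(2,1)]
        ereal_integral_eq[OF \<nu> fm C(2,1)] ereal_diff_convex_comb[OF t, symmetric]
      by (subst nn) auto
  qed
  moreover have "(\<integral>x. apply_bcontfun g x \<partial>\<rho>)
      = t * (\<integral>x. apply_bcontfun g x \<partial>\<mu>) + (1 - t) * (\<integral>x. apply_bcontfun g x \<partial>\<nu>)" for g :: "'a \<Rightarrow>\<^sub>C real"
    using EI[OF bcontfun_bounded_above_borel[of g]]
    by (simp add: ereal_integral_bcontfun \<mu> \<nu> \<rho>)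
  ultimately show ?thesis using \<rho> by blast
qed

subsection \<open>Kantorovich operators, transfers and costs\<close>

text \<open>A Fenchel-Moreau identity in which probability measures suffice as dual variables. One
  inequality comes from choosing g = g0 in the inner supremum, the other from a subgradient at
  \<open>g0\<close>.\<close>

lemma biconjugate:
  fixes p :: "('b::metric_space \<Rightarrow>\<^sub>C real) \<Rightarrow> ereal"
  assumes compact: "compact (UNIV :: 'b set)" and PInf: "\<And>g. p g \<noteq> \<infinity>"
    and mono: "\<And>g h. (\<And>y. apply_bcontfun g y \<le> apply_bcontfun h y) \<Longrightarrow> p g \<le> p h"
    and const: "\<And>g c. p (g + const_bcontfun c) = p g + ereal c"
    and cvx: "\<And>g h t. 0 \<le> t \<Longrightarrow> t \<le> 1 \<Longrightarrow>
      p (t *\<^sub>R g + (1 - t) *\<^sub>R h) \<le> ereal t * p g + ereal (1 - t) * p h"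
  shows "(SUP \<sigma>\<in>prob_measures. ereal (\<integral>y. apply_bcontfun g0 y \<partial>\<sigma>)
    - (SUP g. ereal (\<integral>y. apply_bcontfun g y \<partial>\<sigma>) - p g)) = p g0"
proof -
  have lip: "p g \<le> p h + ereal (norm (g - h))" for g h
  proof -
    have "p g \<le> p (h + const_bcontfun (norm (g - h)))"
    proof (rule mono)
      fix y
      show "apply_bcontfun g y \<le> apply_bcontfun (h + const_bcontfun (norm (g - h))) y"
        using norm_bounded[of "g - h" y] by (simp add: const_bcontfun.rep_eq abs_le_iff)
    qed
    then show ?thesis by (simp only: const)
  qed
  show ?thesis
  proof (cases "p 0 = - \<infinity>")
    case True
    \<comment> \<open>For identically -infinite \<open>p\<close> each inner supremum is infinity, so
      the outer one is -infinity as well.\<close>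
    then have MInf: "p g = - \<infinity>" for g using lip[of g 0] by simp
    show ?thesis by (simp add: MInf SUP_constant bot_ereal_def)
  next
    case False
    have "p g \<noteq> - \<infinity>" for g using lip[of 0 g] False PInf[of 0] by auto
    then have fin: "\<bar>p g\<bar> \<noteq> \<infinity>" for g using PInf[of g] by auto
    define r where "r g = real_of_ereal (p g)" for g
    have pr: "p g = ereal (r g)" for g unfolding r_def using fin by (simp add: ereal_real')
    have "convex_on UNIV r"
      unfolding convex_on_def
    proof (intro conjI ballI allI impI)
      fix g h and u v :: real assume "0 \<le> u" "0 \<le> v" "u + v = 1"
      then have "v = 1 - u" "u \<le> 1" by auto
      then show "r (u *\<^sub>R g + v *\<^sub>R h) \<le> u * r g + v * r h"
        using cvx[of u g h] \<open>0 \<le> u\<close> by (simp add: pr)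
    qed simp
    moreover have "r g \<le> r h" if "\<And>y. apply_bcontfun g y \<le> apply_bcontfun h y" for g h
      using mono[OF that] by (simp add: pr)
    moreover have "r (g + const_bcontfun c) = r g + c" for g c
      using const[of g c] by (simp add: pr)
    ultimately obtain \<sigma> where \<sigma>: "\<sigma> \<in> prob_measures"
      "\<And>g. (\<integral>y. apply_bcontfun g y \<partial>\<sigma>) - r g \<le> (\<integral>y. apply_bcontfun g0 y \<partial>\<sigma>) - r g0"
      using subgradient_measure[OF compact, of r g0] by blast
    show ?thesis
    proof (rule antisym)
      show "(SUP \<sigma>\<in>prob_measures. ereal (\<integral>y. apply_bcontfun g0 y \<partial>\<sigma>)
        - (SUP g. ereal (\<integral>y. apply_bcontfun g y \<partial>\<sigma>) - p g)) \<le> p g0"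
      proof (rule SUP_least)
        fix \<tau> :: "'b measure"
        have "ereal (\<integral>y. apply_bcontfun g0 y \<partial>\<tau>) - (SUP g. ereal (\<integral>y. apply_bcontfun g y \<partial>\<tau>) - p g)
            \<le> ereal (\<integral>y. apply_bcontfun g0 y \<partial>\<tau>) - (ereal (\<integral>y. apply_bcontfun g0 y \<partial>\<tau>) - p g0)"
          by (intro ereal_minus_mono SUP_upper) auto
        then show "ereal (\<integral>y. apply_bcontfun g0 y \<partial>\<tau>)
            - (SUP g. ereal (\<integral>y. apply_bcontfun g y \<partial>\<tau>) - p g) \<le> p g0"
          by (simp add: pr)
      qed
      have "(SUP g. ereal (\<integral>y. apply_bcontfun g y \<partial>\<sigma>) - p g)
          \<le> ereal ((\<integral>y. apply_bcontfun g0 y \<partial>\<sigma>) - r g0)"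
        using \<sigma>(2) by (intro SUP_least) (simp add: pr)
      then have "p g0 \<le> ereal (\<integral>y. apply_bcontfun g0 y \<partial>\<sigma>)
          - (SUP g. ereal (\<integral>y. apply_bcontfun g y \<partial>\<sigma>) - p g)"
        using ereal_minus_mono[OF order_refl, of _ "ereal ((\<integral>y. apply_bcontfun g0 y \<partial>\<sigma>) - r g0)"
            "ereal (\<integral>y. apply_bcontfun g0 y \<partial>\<sigma>)"] by (simp add: pr)
      then show "p g0 \<le> (SUP \<sigma>\<in>prob_measures. ereal (\<integral>y. apply_bcontfun g0 y \<partial>\<sigma>)
        - (SUP g. ereal (\<integral>y. apply_bcontfun g y \<partial>\<sigma>) - p g))"
        using \<sigma>(1) by (intro SUP_upper2)
    qed
  qed
qed

section \<open>The transfer generated by a Kantorovich operator\<close>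

text \<open>The second argument meets only real continuous functions, so
  \<open>signed_integral\<close> serves for it. The first must integrate \<open>T g\<close>, which
  can be -infinity, and is therefore turned back into a measure by inverting
  \<open>signed_of\<close>.\<close>

definition lifted_transfer ::
  "(('b::metric_space \<Rightarrow>\<^sub>C real) \<Rightarrow> 'a::metric_space \<Rightarrow> ereal) \<Rightarrow> 'a signed_measure \<times> 'b signed_measure \<Rightarrow> ereal"
  where
  "lifted_transfer T = (\<lambda>(\<nu>, \<tau>).
    if \<nu> \<in> signed_of ` prob_measures \<and> \<tau> \<in> signed_of ` prob_measures
    then SUP g. ereal (signed_integral \<tau> (apply_bcontfun g))
      - ereal_integral (the_inv_into prob_measures signed_of \<nu>) (T g)
    else \<infinity>)"

lemma lifted_transfer_prob:
  "\<mu> \<in> prob_measures \<Longrightarrow> \<sigma> \<in> prob_measures \<Longrightarrow> lifted_transfer T (signed_of \<mu>, signed_of \<sigma>)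
    = (SUP g. ereal (\<integral>y. apply_bcontfun g y \<partial>\<sigma>) - ereal_integral \<mu> (T g))"
  by (simp add: lifted_transfer_def the_inv_into_f_f[OF inj_on_signed_of] signed_integral_prob)

lemma lifted_transfer_outside:
  "\<nu> \<notin> signed_of ` prob_measures \<or> \<tau> \<notin> signed_of ` prob_measures \<Longrightarrow> lifted_transfer T (\<nu>, \<tau>) = \<infinity>"
  by (auto simp: lifted_transfer_def)

text \<open>For continuous \<open>F n\<close> decreasing to \<open>f\<close>, minus the integral of
  \<open>f\<close> is the supremum of minus the integrals of \<open>F n\<close>. The set is thus an
  intersection of closed sets with the closed set of pairs of probability measures.\<close>

lemma closed_prob_sublevel:
  fixes f :: "'a::metric_space \<Rightarrow> ereal" and g :: "'b::metric_space \<Rightarrow>\<^sub>C real"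
  assumes compact: "compact (UNIV :: 'a set)" "compact (UNIV :: 'b set)" and f: "f \<in> USC"
  shows "closed {z. \<exists>\<mu>\<in>prob_measures. \<exists>\<sigma>\<in>prob_measures. z = (signed_of \<mu>, signed_of \<sigma>) \<and>
    ereal (\<integral>y. apply_bcontfun g y \<partial>\<sigma>) - ereal_integral \<mu> f \<le> a}" (is "closed ?S")
proof -
  obtain F :: "nat \<Rightarrow> 'a \<Rightarrow>\<^sub>C real" where
    dec: "\<And>n x. apply_bcontfun (F (Suc n)) x \<le> apply_bcontfun (F n) x" and
    F: "f = (\<lambda>x. INF n. ereal (apply_bcontfun (F n) x))"
    using USC_INF_continuous[OF compact(1) f] by (auto simp: fun_eq_iff)
  have "ereal (\<integral>y. apply_bcontfun g y \<partial>\<sigma>) - ereal_integral \<mu> f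
      = (SUP n. ereal (signed_integral (signed_of \<sigma>) (apply_bcontfun g)
          - signed_integral (signed_of \<mu>) (apply_bcontfun (F n))))"
    if \<mu>: "\<mu> \<in> prob_measures" and \<sigma>: "\<sigma> \<in> prob_measures" for \<mu> \<sigma>
  proof -
    have "\<exists>B. \<forall>x. \<bar>apply_bcontfun (F n) x\<bar> \<le> B" for n
      using norm_bounded[of "F n"] by auto
    then have "ereal_integral \<mu> f = (INF n. ereal (\<integral>x. apply_bcontfun (F n) x \<partial>\<mu>))"
      unfolding F using dec by (intro ereal_integral_INF[OF \<mu>] borel_measurable_continuous_onI) auto
    then show ?thesis
      by (simp add: SUP_ereal_minus_right[symmetric] signed_integral_prob \<mu> \<sigma>)
  qed
  then have "?S = (signed_of ` prob_measures \<times> signed_of ` prob_measures) \<inter>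
      (\<Inter>n. {z. ereal (signed_integral (snd z) (apply_bcontfun g)
          - signed_integral (fst z) (apply_bcontfun (F n))) \<le> a})"
    by (auto simp: SUP_le_iff) blast
  also have "closed \<dots>"
  proof (intro closed_Int closed_Times closed_INT ballI closed_signed_prob_measures compact)
    fix n
    have "continuous_on UNIV (\<lambda>z :: 'a signed_measure \<times> 'b signed_measure.
        signed_integral (snd z) (apply_bcontfun g) - signed_integral (fst z) (apply_bcontfun (F n)))"
      by (intro continuous_on_diff continuous_on_compose2[OF continuous_signed_integral]
          continuous_on_fst continuous_on_snd continuous_on_id) auto
    then show "closed {z :: 'a signed_measure \<times> 'b signed_measure. ereal (signed_integral (snd z) (apply_bcontfun g)
          - signed_integral (fst z) (apply_bcontfun (F n))) \<le> a}"
      by (intro closed_Collect_le continuous_on_ereal continuous_on_const)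
  qed
  finally show ?thesis .
qed

context
  fixes T :: "('b::metric_space \<Rightarrow>\<^sub>C real) \<Rightarrow> 'a::metric_space \<Rightarrow> ereal"
  assumes compact: "compact (UNIV :: 'a set)" "compact (UNIV :: 'b set)"
    and T: "backward_Kantorovich_operator T"
begin

lemma operator_USC: "T g \<in> USC"
  and operator_mono: "(\<And>y. apply_bcontfun g y \<le> apply_bcontfun h y) \<Longrightarrow> T g x \<le> T h x"
  and operator_const: "T (g + const_bcontfun c) x = T g x + ereal c"
  and operator_convex: "0 \<le> t \<Longrightarrow> t \<le> 1 \<Longrightarrow>
    T (t *\<^sub>R g + (1 - t) *\<^sub>R h) x \<le> ereal t * T g x + ereal (1 - t) * T h x"
  using T by (simp_all add: backward_Kantorovich_operator_def)

lemma operator_bounded_above_borel: "T g \<in> bounded_above_borel"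
  by (rule USC_bounded_above_borel[OF operator_USC])

text \<open>\<open>biconjugate\<close> applies to the averaged operator. For some \<mu> the average
  may be -infinity for all \<open>g\<close>, which is why that lemma excludes only the value
  infinity.\<close>

lemma transfer_conj_lifted_transfer:
  assumes \<mu>: "\<mu> \<in> prob_measures"
  shows "transfer_conj (lifted_transfer T) \<mu> g0 = ereal_integral \<mu> (T g0)"
proof -
  have "(SUP \<sigma>\<in>prob_measures. ereal (\<integral>y. apply_bcontfun g0 y \<partial>\<sigma>)
      - (SUP g. ereal (\<integral>y. apply_bcontfun g y \<partial>\<sigma>) - ereal_integral \<mu> (T g))) = ereal_integral \<mu> (T g0)"
  proof (rule biconjugate[OF compact(2)])
    show "ereal_integral \<mu> (T g) \<noteq> \<infinity>" for g
      by (rule ereal_integral_neq_PInf[OF \<mu> operator_bounded_above_borel])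
    show "ereal_integral \<mu> (T g) \<le> ereal_integral \<mu> (T h)"
      if "\<And>y. apply_bcontfun g y \<le> apply_bcontfun h y" for g h
      by (intro ereal_integral_mono operator_mono that)
    show "ereal_integral \<mu> (T (g + const_bcontfun c)) = ereal_integral \<mu> (T g) + ereal c" for g c
    proof -
      have "T (g + const_bcontfun c) = (\<lambda>x. T g x + ereal c)"
        by (rule ext) (rule operator_const)
      then show ?thesis
        using ereal_integral_add_const[OF \<mu> operator_bounded_above_borel] by simp
    qed
    show "ereal_integral \<mu> (T (t *\<^sub>R g + (1 - t) *\<^sub>R h))
        \<le> ereal t * ereal_integral \<mu> (T g) + ereal (1 - t) * ereal_integral \<mu> (T h)"
      if "0 \<le> t" "t \<le> 1" for g h t
      unfolding ereal_integral_convex_comb[OF \<mu> operator_bounded_above_borel operator_bounded_above_borel that, symmetric]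
      by (intro ereal_integral_mono operator_convex that)
  qed
  then show ?thesis by (simp add: transfer_conj_def lifted_transfer_prob \<mu>)
qed

text \<open>The single competitor g = 0 suffices: it contributes minus the integral of
  \<open>T 0\<close>, and \<open>T 0\<close> is bounded above.\<close>

lemma lifted_transfer_bounded_below: "\<exists>m::real. \<forall>z. ereal m \<le> lifted_transfer T z"
proof -
  have "bounded_above (T 0)" using operator_USC by (simp add: USC_def)
  then obtain C where C: "0 \<le> C" "\<And>x. T 0 x \<le> ereal C"
    by (rule bounded_aboveE[where B=0]) auto
  have "ereal (- C) \<le> lifted_transfer T (\<nu>, \<tau>)" for \<nu> \<tau>
  proof (cases "\<nu> \<in> signed_of ` prob_measures \<and> \<tau> \<in> signed_of ` prob_measures")
    case True
    then obtain \<mu> \<sigma> where p: "\<mu> \<in> prob_measures" "\<sigma> \<in> prob_measures" "\<nu> = signed_of \<mu>" "\<tau> = signed_of \<sigma>"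
      by blast
    have "ereal_integral \<mu> (T 0) \<le> ereal C"
      using operator_bounded_above_borel[of 0] C p
      by (intro ereal_integral_le) (auto simp: bounded_above_borel_def)
    then have "ereal (- C) \<le> ereal (\<integral>y. apply_bcontfun 0 y \<partial>\<sigma>) - ereal_integral \<mu> (T 0)"
      by (cases "ereal_integral \<mu> (T 0)") auto
    also have "\<dots> \<le> lifted_transfer T (\<nu>, \<tau>)"
      unfolding p(3,4) lifted_transfer_prob[OF p(1,2)] by (rule SUP_upper) simp
    finally show ?thesis .
  next
    case False
    then show ?thesis by (simp add: lifted_transfer_outside)
  qed
  then show ?thesis by auto
qed

text \<open>An identically infinite transfer would have conjugate -infinity at every Dirac mass,
  whereas that conjugate is \<open>T 0 x\<close>, which is not -infinity for some
  \<open>x\<close>.\<close>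

lemma lifted_transfer_proper: "\<exists>z. lifted_transfer T z \<noteq> \<infinity>"
proof (rule ccontr)
  assume "\<nexists>z. lifted_transfer T z \<noteq> \<infinity>"
  then have all: "lifted_transfer T z = \<infinity>" for z by blast
  obtain x where "T 0 x \<noteq> - \<infinity>" using operator_USC[of 0] by (auto simp: USC_def)
  moreover have "T 0 x = transfer_conj (lifted_transfer T) (return borel x) 0"
    using operator_bounded_above_borel[of 0]
    by (simp add: transfer_conj_lifted_transfer return_in_prob_measures ereal_integral_return bounded_above_borel_def)
  ultimately show False by (simp add: transfer_conj_def all SUP_constant bot_ereal_def split: if_splits)
qed

text \<open>For fixed \<open>g\<close> the expression under the supremum is affine along mixtures of
  probability measures; the integral of \<open>T g\<close> is never infinity, so no undefined
  difference arises.\<close>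

lemma lifted_transfer_convex:
  assumes t: "0 \<le> t" "t \<le> 1"
  shows "lifted_transfer T (t *\<^sub>R z + (1 - t) *\<^sub>R w)
    \<le> ereal t * lifted_transfer T z + ereal (1 - t) * lifted_transfer T w"
proof -
  have MInf: "lifted_transfer T z \<noteq> - \<infinity>" for z
    using lifted_transfer_bounded_below by (metis MInfty_neq_ereal(1) ereal_infty_less_eq(2))
  consider "t = 0" | "t = 1" | "0 < t" "t < 1" using t by linarith
  then show ?thesis
  proof cases
    case 3
    show ?thesis
    proof (cases "lifted_transfer T z = \<infinity> \<or> lifted_transfer T w = \<infinity>")
      case True
      then show ?thesis
        using 3 MInf[of z] MInf[of w] by (cases "lifted_transfer T z"; cases "lifted_transfer T w") auto
    next
      case False
      then obtain \<mu>1 \<sigma>1 \<mu>2 \<sigma>2 where p: "\<mu>1 \<in> prob_measures" "\<sigma>1 \<in> prob_measures" "\<mu>2 \<in> prob_measures"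
        "\<sigma>2 \<in> prob_measures" "z = (signed_of \<mu>1, signed_of \<sigma>1)" "w = (signed_of \<mu>2, signed_of \<sigma>2)"
        using lifted_transfer_outside[of "fst z" "snd z" T] lifted_transfer_outside[of "fst w" "snd w" T]
        by (auto simp: mem_Times_iff prod_eq_iff)
      obtain \<mu> where \<mu>: "\<mu> \<in> prob_measures" "signed_of \<mu> = t *\<^sub>R signed_of \<mu>1 + (1 - t) *\<^sub>R signed_of \<mu>2"
        "\<And>f. f \<in> bounded_above_borel \<Longrightarrow> ereal_integral \<mu> f
          = ereal t * ereal_integral \<mu>1 f + ereal (1 - t) * ereal_integral \<mu>2 f"
        using mixture[OF p(1,3) 3] by blast
      obtain \<sigma> where \<sigma>: "\<sigma> \<in> prob_measures" "signed_of \<sigma> = t *\<^sub>R signed_of \<sigma>1 + (1 - t) *\<^sub>R signed_of \<sigma>2"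
        "\<And>g :: 'b \<Rightarrow>\<^sub>C real. (\<integral>x. apply_bcontfun g x \<partial>\<sigma>)
          = t * (\<integral>x. apply_bcontfun g x \<partial>\<sigma>1) + (1 - t) * (\<integral>x. apply_bcontfun g x \<partial>\<sigma>2)"
        using mixture[OF p(2,4) 3] by blast
      have zw: "t *\<^sub>R z + (1 - t) *\<^sub>R w = (signed_of \<mu>, signed_of \<sigma>)"
        by (simp add: p \<mu> \<sigma>)
      show ?thesis
        unfolding zw lifted_transfer_prob[OF \<mu>(1) \<sigma>(1)]
      proof (rule SUP_least)
        fix g :: "'b \<Rightarrow>\<^sub>C real"
        let ?a = "\<integral>y. apply_bcontfun g y \<partial>\<sigma>1" and ?b = "\<integral>y. apply_bcontfun g y \<partial>\<sigma>2"
        have T1: "ereal_integral \<mu>1 (T g) \<noteq> \<infinity>" and T2: "ereal_integral \<mu>2 (T g) \<noteq> \<infinity>"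
          by (intro ereal_integral_neq_PInf p operator_bounded_above_borel)+
        have "ereal (\<integral>y. apply_bcontfun g y \<partial>\<sigma>) - ereal_integral \<mu> (T g)
          = ereal t * (ereal ?a - ereal_integral \<mu>1 (T g)) + ereal (1 - t) * (ereal ?b - ereal_integral \<mu>2 (T g))"
          unfolding \<mu>(3)[OF operator_bounded_above_borel] \<sigma>(3) using 3 T1 T2
          by (cases "ereal_integral \<mu>1 (T g)"; cases "ereal_integral \<mu>2 (T g)") (auto simp: algebra_simps)
        also have "\<dots> \<le> ereal t * lifted_transfer T z + ereal (1 - t) * lifted_transfer T w"
          unfolding p(5,6) lifted_transfer_prob[OF p(1,2)] lifted_transfer_prob[OF p(3,4)] using t
          by (intro add_mono ereal_mult_left_mono SUP_upper) auto
        finally show "ereal (\<integral>y. apply_bcontfun g y \<partial>\<sigma>) - ereal_integral \<mu> (T g)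
          \<le> ereal t * lifted_transfer T z + ereal (1 - t) * lifted_transfer T w" .
      qed
    qed
  qed (auto simp flip: zero_ereal_def one_ereal_def)
qed

lemma lifted_transfer_lsc: "lsc_on UNIV (lifted_transfer T)"
  unfolding lsc_on_def
proof
  fix a
  show "closedin (top_of_set UNIV) {z \<in> UNIV. lifted_transfer T z \<le> a}"
  \<comment> \<open>At level infinity the sublevel set is the whole space, including pairs that are
    not probability measures and that the intersection below cannot describe.\<close>
  proof (cases "a = \<infinity>")
    case False
    have "{z. lifted_transfer T z \<le> a} = (\<Inter>g. {z. \<exists>\<mu>\<in>prob_measures. \<exists>\<sigma>\<in>prob_measures.
        z = (signed_of \<mu>, signed_of \<sigma>) \<and> ereal (\<integral>y. apply_bcontfun g y \<partial>\<sigma>) - ereal_integral \<mu> (T g) \<le> a})"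
      (is "_ = (\<Inter>g. ?S g)")
    proof (intro set_eqI iffI)
      fix z assume z: "z \<in> {z. lifted_transfer T z \<le> a}"
      then have "lifted_transfer T (fst z, snd z) \<noteq> \<infinity>" using False by auto
      then obtain \<mu> \<sigma> where p: "\<mu> \<in> prob_measures" "\<sigma> \<in> prob_measures" "z = (signed_of \<mu>, signed_of \<sigma>)"
        using lifted_transfer_outside[of "fst z" "snd z" T] by (metis imageE prod.collapse)
      then show "z \<in> (\<Inter>g. ?S g)" using z by (auto simp: lifted_transfer_prob SUP_le_iff)
    next
      fix z assume z: "z \<in> (\<Inter>g. ?S g)"
      then obtain \<mu> \<sigma> where p: "\<mu> \<in> prob_measures" "\<sigma> \<in> prob_measures" "z = (signed_of \<mu>, signed_of \<sigma>)"
        by blast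
      \<comment> \<open>Membership in the intersection supplies a pair of measures for each
        \<open>g\<close> separately; injectivity of \<open>signed_of\<close> identifies them
        all.\<close>
      have "ereal (\<integral>y. apply_bcontfun g y \<partial>\<sigma>) - ereal_integral \<mu> (T g) \<le> a" for g
      proof -
        obtain \<mu>' \<sigma>' where q: "\<mu>' \<in> prob_measures" "\<sigma>' \<in> prob_measures" "z = (signed_of \<mu>', signed_of \<sigma>')"
          "ereal (\<integral>y. apply_bcontfun g y \<partial>\<sigma>') - ereal_integral \<mu>' (T g) \<le> a"
          using z by blast
        then have "\<mu>' = \<mu>" "\<sigma>' = \<sigma>"
          using p inj_onD[OF inj_on_signed_of] by auto
        then show ?thesis using q by simp
      qed
      then show "z \<in> {z. lifted_transfer T z \<le> a}"
        by (simp add: p lifted_transfer_prob SUP_le_iff)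
    qed
    also have "closed \<dots>"
      by (intro closed_INT ballI closed_prob_sublevel compact operator_USC)
    finally show ?thesis by simp
  qed simp
qed

lemma lifted_transfer_backward_linear_transfer: "backward_linear_transfer (lifted_transfer T)"
  unfolding backward_linear_transfer_def
proof (intro conjI)
  show "\<forall>z. lifted_transfer T z \<noteq> - \<infinity>"
    using lifted_transfer_bounded_below by (metis MInfty_neq_ereal(1) ereal_infty_less_eq(2))
  show "{z. lifted_transfer T z < \<infinity>} \<subseteq> (signed_of ` prob_measures) \<times> (signed_of ` prob_measures)"
    using lifted_transfer_outside[of _ _ T] by force
  show "\<exists>S :: ('b \<Rightarrow>\<^sub>C real) \<Rightarrow> 'a \<Rightarrow> ereal. (\<forall>g. S g \<in> bounded_above_borel) \<and>
        (\<forall>\<mu>\<in>prob_measures. \<forall>g. transfer_conj (lifted_transfer T) \<mu> g = ereal_integral \<mu> (S g))"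
    using operator_bounded_above_borel transfer_conj_lifted_transfer by blast
  show "\<forall>p q t. 0 \<le> t \<and> t \<le> 1 \<longrightarrow> lifted_transfer T (t *\<^sub>R p + (1 - t) *\<^sub>R q)
      \<le> ereal t * lifted_transfer T p + ereal (1 - t) * lifted_transfer T q"
    by (intro allI impI lifted_transfer_convex) auto
qed (intro lifted_transfer_proper lifted_transfer_bounded_below lifted_transfer_lsc)+

end

section \<open>From transfers to costs\<close>

lemma transfer_imp_cost:
  fixes T :: "('b::metric_space \<Rightarrow>\<^sub>C real) \<Rightarrow> 'a::metric_space \<Rightarrow> ereal"
  assumes T: "\<And>g. T g \<in> bounded_above_borel" and tr: "backward_linear_transfer \<T>"
    and conj: "\<And>\<mu> g. \<mu> \<in> prob_measures \<Longrightarrow> transfer_conj \<T> \<mu> g = ereal_integral \<mu> (T g)"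
  shows "\<exists>c :: 'a \<times> 'b signed_measure \<Rightarrow> ereal.
         (\<forall>x. \<forall>\<sigma>\<in>signed_of ` prob_measures. c (x, \<sigma>) \<noteq> - \<infinity>) \<and>
         (\<exists>x. \<exists>\<sigma>\<in>signed_of ` prob_measures. c (x, \<sigma>) \<noteq> \<infinity>) \<and>
         lsc_on (UNIV \<times> signed_of ` prob_measures) c \<and>
         (\<forall>x. \<forall>\<sigma>1\<in>signed_of ` prob_measures. \<forall>\<sigma>2\<in>signed_of ` prob_measures.
            \<forall>t. 0 \<le> t \<and> t \<le> 1 \<longrightarrow>
              c (x, t *\<^sub>R \<sigma>1 + (1 - t) *\<^sub>R \<sigma>2)
                \<le> ereal t * c (x, \<sigma>1) + ereal (1 - t) * c (x, \<sigma>2)) \<and>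
         (\<forall>g x. T g x =
            (SUP \<sigma>\<in>prob_measures. ereal (\<integral>y. apply_bcontfun g y \<partial>\<sigma>) - c (x, signed_of \<sigma>)))"
proof -
  define c where "c = (\<lambda>(x :: 'a, \<tau>). \<T> (signed_of (return borel x), \<tau>))"
  have rep: "T g x = (SUP \<sigma>\<in>prob_measures. ereal (\<integral>y. apply_bcontfun g y \<partial>\<sigma>) - c (x, signed_of \<sigma>))" for g x
    using conj[OF return_in_prob_measures, of x g] T[of g]
    by (simp add: transfer_conj_def c_def ereal_integral_return bounded_above_borel_def)
  have MInf: "\<T> z \<noteq> - \<infinity>" for z
    using tr unfolding backward_linear_transfer_def by blast
  have cvx: "\<T> (t *\<^sub>R z + (1 - t) *\<^sub>R w) \<le> ereal t * \<T> z + ereal (1 - t) * \<T> w" if "0 \<le> t" "t \<le> 1" for z w t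
    using tr that unfolding backward_linear_transfer_def by blast
  have lsc: "closed {z. \<T> z \<le> a}" for a
    using tr by (simp add: backward_linear_transfer_def lsc_on_def)
  obtain z where z: "\<T> z \<noteq> \<infinity>" using tr by (auto simp: backward_linear_transfer_def)
  have dom: "{z. \<T> z < \<infinity>} \<subseteq> (signed_of ` prob_measures) \<times> (signed_of ` prob_measures)"
    using tr by (simp add: backward_linear_transfer_def)
  have "z \<in> {z. \<T> z < \<infinity>}" using z by simp
  with dom have "z \<in> (signed_of ` prob_measures) \<times> (signed_of ` prob_measures)" by blast
  then obtain \<mu> \<sigma> where p: "\<mu> \<in> prob_measures" "\<sigma> \<in> prob_measures" "z = (signed_of \<mu>, signed_of \<sigma>)"
    by blast
  \<comment> \<open>The point where the transfer is finite need not have a Dirac mass as first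
    component. If all costs were infinite, \<open>T 0\<close> would be identically -infinity, hence
    so would its integral against \<mu>, contradicting finiteness at \<open>z\<close>.\<close>
  have "\<exists>x. \<exists>\<sigma>\<in>signed_of ` prob_measures. c (x, \<sigma>) \<noteq> \<infinity>"
  proof (rule ccontr)
    assume "\<not> ?thesis"
    then have "c (x, signed_of \<sigma>) = \<infinity>" if "\<sigma> \<in> prob_measures" for x \<sigma> using that by blast
    then have "T 0 x = - \<infinity>" for x
      unfolding rep by (simp add: SUP_constant bot_ereal_def)
    then have "transfer_conj \<T> \<mu> 0 = - \<infinity>"
      unfolding conj[OF p(1)] by (intro ereal_integral_eq_MInf p)
    moreover have "ereal (\<integral>y. apply_bcontfun 0 y \<partial>\<sigma>) - \<T> z \<le> transfer_conj \<T> \<mu> 0"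
      unfolding transfer_conj_def p(3) by (intro SUP_upper p)
    ultimately show False using z by (cases "\<T> z") auto
  qed
  moreover have "lsc_on (UNIV \<times> signed_of ` prob_measures) c"
    unfolding lsc_on_def
  proof
    fix a
    have "continuous_on UNIV (\<lambda>w :: 'a \<times> 'b signed_measure. (signed_of (return borel (fst w)), snd w))"
      by (intro continuous_on_Pair continuous_on_compose2[OF continuous_signed_of_return]
          continuous_on_fst continuous_on_snd continuous_on_id) auto
    from closed_vimage[OF lsc[of a] this]
    have "closed {w. c w \<le> a}" by (simp add: vimage_def c_def case_prod_beta)
    moreover have "{w \<in> UNIV \<times> signed_of ` prob_measures. c w \<le> a}
        = UNIV \<times> signed_of ` prob_measures \<inter> {w. c w \<le> a}" by blast
    ultimately show "closedin (top_of_set (UNIV \<times> signed_of ` prob_measures))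
        {w \<in> UNIV \<times> signed_of ` prob_measures. c w \<le> a}"
      by (simp only: closedin_closed_Int)
  qed
  moreover have "c (x, t *\<^sub>R \<sigma>1 + (1 - t) *\<^sub>R \<sigma>2) \<le> ereal t * c (x, \<sigma>1) + ereal (1 - t) * c (x, \<sigma>2)"
    if "0 \<le> t" "t \<le> 1" for x \<sigma>1 \<sigma>2 t
    \<comment> \<open>The first component stays fixed, since t and 1 - t times the same Dirac mass
      add up to it.\<close>
    using cvx[OF that, of "(signed_of (return borel x), \<sigma>1)" "(signed_of (return borel x), \<sigma>2)"]
    by (simp add: c_def flip: scaleR_left.add)
  moreover have "c (x, \<tau>) \<noteq> - \<infinity>" for x \<tau> by (simp add: c_def MInf)
  ultimately show ?thesis
    by (intro exI[of _ c] conjI allI ballI impI rep) blast+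
qed

section \<open>From costs back to operators\<close>

text \<open>Compactness of the set of probability measures enters through the tube lemma: strict
  superlevel sets of \<open>(x, \<sigma>) \<mapsto> c (x, \<sigma>) - \<integral> g d\<sigma>\<close> are open.\<close>

lemma cost_imp_usc:
  fixes c :: "'a::metric_space \<times> 'b::metric_space signed_measure \<Rightarrow> ereal"
  assumes compact: "compact (UNIV :: 'b set)"
    and lsc: "lsc_on (UNIV \<times> signed_of ` prob_measures) c"
    and f: "\<And>x. f x = (SUP \<sigma>\<in>prob_measures. ereal (\<integral>y. apply_bcontfun g y \<partial>\<sigma>) - c (x, signed_of \<sigma>))"
  shows "usc f"
  unfolding usc_def
proof
  fix a
  let ?P = "signed_of ` prob_measures :: 'b signed_measure set"
  let ?I = "\<lambda>\<tau>. signed_integral \<tau> (apply_bcontfun g)"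
  have "\<exists>K. closed K \<and> {z \<in> UNIV \<times> ?P. c z \<le> ereal q} = UNIV \<times> ?P \<inter> K" for q
    using lsc unfolding lsc_on_def closedin_closed by blast
  \<comment> \<open>Lower semicontinuity is known only relative to the probability measures, whereas
    the tube argument wants open sets of the full product; \<open>K q\<close> extends the sublevel
    set of level \<open>q\<close>.\<close>
  then obtain K where K: "\<And>q. closed (K q)" "\<And>q. {z \<in> UNIV \<times> ?P. c z \<le> ereal q} = UNIV \<times> ?P \<inter> K q"
    by metis
  have K_iff: "(x, \<tau>) \<in> K q \<longleftrightarrow> c (x, \<tau>) \<le> ereal q" if "\<tau> \<in> ?P" for x \<tau> q
    using K(2)[of q] that by blast
  have "open {x. f x < a}"
  proof (subst open_subopen, clarify)
    fix x0 assume "f x0 < a"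
    \<comment> \<open>An intermediate level is needed because a supremum of terms below
      \<open>b\<close> is only known to be at most \<open>b\<close>.\<close>
    then obtain b where b: "f x0 < ereal b" "ereal b < a" by (metis ereal_dense2)
    \<comment> \<open>On probability measures, c > q and integral < q + b for some real q means that
      integral minus c is below b. Splitting the difference at q gives a union of open sets and
      handles infinite c.\<close>
    define W where "W = (\<Union>q. - K q \<inter> {w :: 'a \<times> 'b signed_measure. ?I (snd w) < q + b})"
    have "continuous_on UNIV (\<lambda>w :: 'a \<times> 'b signed_measure. ?I (snd w))"
      by (intro continuous_on_compose2[OF continuous_signed_integral] continuous_on_snd continuous_on_id) auto
    then have "open W"
      unfolding W_def
      by (intro open_UN ballI open_Int open_Compl K open_Collect_less continuous_on_const)
    moreover have "{x0} \<times> ?P \<subseteq> W"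
    proof clarify
      fix \<sigma> :: "'b measure" assume \<sigma>: "\<sigma> \<in> prob_measures"
      have "ereal (?I (signed_of \<sigma>)) - c (x0, signed_of \<sigma>) \<le> f x0"
        unfolding f signed_integral_prob[OF \<sigma>] by (intro SUP_upper \<sigma>)
      then have "ereal (?I (signed_of \<sigma>) - b) < c (x0, signed_of \<sigma>)"
        using b(1) by (cases "f x0"; cases "c (x0, signed_of \<sigma>)") auto
      then obtain q where "ereal (?I (signed_of \<sigma>) - b) < ereal q" "ereal q < c (x0, signed_of \<sigma>)"
        by (metis ereal_dense2)
      then show "(x0, signed_of \<sigma>) \<in> W"
        using \<sigma> by (auto simp: W_def K_iff not_le intro!: exI[of _ q])
    qed
    ultimately obtain X where X: "x0 \<in> X" "open X" "X \<times> ?P \<subseteq> W"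
      using Elementary_Topology.tube_lemma[OF compact_signed_prob_measures[OF compact], of W x0] by blast
    have "f x < a" if x: "x \<in> X" for x
    proof -
      have "f x \<le> ereal b"
        unfolding f
      proof (rule SUP_least)
        fix \<sigma> :: "'b measure" assume \<sigma>: "\<sigma> \<in> prob_measures"
        then have "(x, signed_of \<sigma>) \<in> W" using X(3) x by blast
        then obtain q where "ereal q < c (x, signed_of \<sigma>)" "?I (signed_of \<sigma>) < q + b"
          using \<sigma> by (auto simp: W_def K_iff not_le)
        then show "ereal (\<integral>y. apply_bcontfun g y \<partial>\<sigma>) - c (x, signed_of \<sigma>) \<le> ereal b"
          by (cases "c (x, signed_of \<sigma>)") (auto simp: signed_integral_prob \<sigma>)
      qed
      then show ?thesis using b(2) by (rule le_less_trans)
    qed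
    then show "\<exists>U. open U \<and> x0 \<in> U \<and> U \<subseteq> {x. f x < a}" using X by blast
  qed
  then show "closed {x. a \<le> f x}" by (simp add: closed_def Compl_eq not_le)
qed

text \<open>The open sets \<open>{x. f x < ereal (real n)}\<close> cover the space because
  \<open>f\<close> omits infinity; compactness leaves finitely many.\<close>

lemma usc_bounded_above:
  assumes compact: "compact (UNIV :: 'a::topological_space set)" and f: "usc f"
    and PInf: "\<And>x :: 'a. f x \<noteq> \<infinity>"
  shows "bounded_above f"
proof -
  have op: "open {x. f x < ereal (real n)}" for n
  proof -
    have "{x. f x < ereal (real n)} = - {x. ereal (real n) \<le> f x}" by (auto simp: not_le)
    then show ?thesis using f by (simp add: usc_def open_Compl)
  qed
  have cover: "UNIV \<subseteq> (\<Union>n\<in>UNIV. {x. f x < ereal (real n)})"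
  proof
    fix x
    have "\<exists>n. f x < ereal (real n)"
      using PInf[of x] reals_Archimedean2[of "real_of_ereal (f x)"] by (cases "f x") auto
    then show "x \<in> (\<Union>n\<in>UNIV. {x. f x < ereal (real n)})" by blast
  qed
  obtain I where I: "finite I" "UNIV \<subseteq> (\<Union>n\<in>I. {x. f x < ereal (real n)})"
    by (rule compactE_image[OF compact op cover])
  have "f x \<le> ereal (real (Max (insert 0 I)))" for x
  proof -
    obtain n where n: "n \<in> I" "f x < ereal (real n)" using I(2) by blast
    then have "real n \<le> real (Max (insert 0 I))" using I(1) by simp
    then show ?thesis using n(2) by (metis ereal_less_eq(3) less_imp_le order_trans)
  qed
  then show ?thesis by (auto simp: bounded_above_def)
qed

text \<open>For fixed \<sigma> and finite cost, the integral of g minus the cost is monotone, affine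
  and norm-continuous in g and follows shifts by constants. The supremum keeps these properties,
  with affine weakened to convex and continuous to lower semicontinuous; infinite costs contribute
  only -infinity.\<close>

lemma cost_imp_operator:
  fixes T :: "('b::metric_space \<Rightarrow>\<^sub>C real) \<Rightarrow> 'a::metric_space \<Rightarrow> ereal"
  assumes compact: "compact (UNIV :: 'a set)" "compact (UNIV :: 'b set)"
    and PInf: "\<And>g x. T g x \<noteq> \<infinity>"
    and MInf: "\<And>x \<sigma>. \<sigma> \<in> prob_measures \<Longrightarrow> c (x, signed_of \<sigma>) \<noteq> - \<infinity>"
    and proper: "\<exists>x. \<exists>\<sigma>\<in>prob_measures. c (x, signed_of \<sigma>) \<noteq> \<infinity>"
    and lsc: "lsc_on (UNIV \<times> signed_of ` prob_measures) c"
    and rep: "\<And>g x. T g x =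
      (SUP \<sigma>\<in>prob_measures. ereal (\<integral>y. apply_bcontfun g y \<partial>\<sigma>) - c (x, signed_of \<sigma>))"
  shows "backward_Kantorovich_operator T"
proof -
  have upper: "ereal (\<integral>y. apply_bcontfun g y \<partial>\<sigma>) - c (x, signed_of \<sigma>) \<le> T g x"
    if "\<sigma> \<in> prob_measures" for g x \<sigma>
    unfolding rep by (intro SUP_upper that)
  have usc: "usc (T g)" for g by (rule cost_imp_usc[OF compact(2) lsc rep])
  have "T g \<in> USC" for g
  proof -
    obtain x \<sigma> where "\<sigma> \<in> prob_measures" "c (x, signed_of \<sigma>) \<noteq> \<infinity>" using proper by blast
    then have "T g x \<noteq> - \<infinity>"
      using upper[of \<sigma> g x] by (cases "c (x, signed_of \<sigma>)") auto
    then show ?thesis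
      using usc usc_bounded_above[OF compact(1) usc PInf] by (auto simp: USC_def)
  qed
  moreover have "T g x \<le> T h x" if "\<And>y. apply_bcontfun g y \<le> apply_bcontfun h y" for g h x
    unfolding rep
  proof (rule SUP_mono)
    fix \<sigma> :: "'b measure" assume \<sigma>: "\<sigma> \<in> prob_measures"
    have "(\<integral>y. apply_bcontfun g y \<partial>\<sigma>) \<le> (\<integral>y. apply_bcontfun h y \<partial>\<sigma>)"
      by (intro integral_mono integrable_bcontfun \<sigma> that)
    then show "\<exists>\<tau>\<in>prob_measures. ereal (\<integral>y. apply_bcontfun g y \<partial>\<sigma>) - c (x, signed_of \<sigma>)
        \<le> ereal (\<integral>y. apply_bcontfun h y \<partial>\<tau>) - c (x, signed_of \<tau>)"
      by (intro bexI[of _ \<sigma>] ereal_minus_mono \<sigma>) auto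
  qed
  moreover have "T (g + const_bcontfun k) x = T g x + ereal k" for g k x
  proof -
    have "ereal (\<integral>y. apply_bcontfun (g + const_bcontfun k) y \<partial>\<sigma>) - c (x, signed_of \<sigma>)
        = (ereal (\<integral>y. apply_bcontfun g y \<partial>\<sigma>) - c (x, signed_of \<sigma>)) + ereal k"
      if \<sigma>: "\<sigma> \<in> prob_measures" for \<sigma>
    proof -
      interpret prob_space \<sigma> using prob_measuresD[OF \<sigma>] by simp
      have "(\<integral>y. apply_bcontfun (g + const_bcontfun k) y \<partial>\<sigma>) = (\<integral>y. apply_bcontfun g y \<partial>\<sigma>) + k"
        using integrable_bcontfun[OF \<sigma>, of g] prob_space by (simp add: const_bcontfun.rep_eq)
      then show ?thesis by (cases "c (x, signed_of \<sigma>)") auto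
    qed
    moreover have "prob_measures \<noteq> ({} :: 'b measure set)" using return_in_prob_measures by blast
    ultimately show ?thesis unfolding rep by (simp add: SUP_ereal_add_left)
  qed
  moreover have "T (t *\<^sub>R g + (1 - t) *\<^sub>R h) x \<le> ereal t * T g x + ereal (1 - t) * T h x"
    if t: "0 \<le> t" "t \<le> 1" for g h t x
    unfolding rep[of "t *\<^sub>R g + (1 - t) *\<^sub>R h"]
  proof (rule SUP_least)
    fix \<sigma> :: "'b measure" assume \<sigma>: "\<sigma> \<in> prob_measures"
    let ?a = "\<integral>y. apply_bcontfun g y \<partial>\<sigma>" and ?b = "\<integral>y. apply_bcontfun h y \<partial>\<sigma>"
    have int: "(\<integral>y. apply_bcontfun (t *\<^sub>R g + (1 - t) *\<^sub>R h) y \<partial>\<sigma>) = t * ?a + (1 - t) * ?b"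
      using integrable_bcontfun[OF \<sigma>] by simp
    show "ereal (\<integral>y. apply_bcontfun (t *\<^sub>R g + (1 - t) *\<^sub>R h) y \<partial>\<sigma>) - c (x, signed_of \<sigma>)
        \<le> ereal t * T g x + ereal (1 - t) * T h x"
    proof (cases "c (x, signed_of \<sigma>)")
      case (real k)
      have "ereal (\<integral>y. apply_bcontfun (t *\<^sub>R g + (1 - t) *\<^sub>R h) y \<partial>\<sigma>) - c (x, signed_of \<sigma>)
          = ereal t * (ereal ?a - c (x, signed_of \<sigma>)) + ereal (1 - t) * (ereal ?b - c (x, signed_of \<sigma>))"
        unfolding int by (simp add: real algebra_simps)
      also have "\<dots> \<le> ereal t * T g x + ereal (1 - t) * T h x"
        using t by (intro add_mono ereal_mult_left_mono upper \<sigma>) auto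
      finally show ?thesis .
    qed (use MInf[OF \<sigma>] in auto)
  qed
  moreover have "T g x \<le> liminf (\<lambda>n. T (gs n) x)" if gs: "gs \<longlonglongrightarrow> g" for gs g x
    unfolding rep[of g]
  proof (rule SUP_least)
    fix \<sigma> :: "'b measure" assume \<sigma>: "\<sigma> \<in> prob_measures"
    interpret prob_space \<sigma> using prob_measuresD[OF \<sigma>] by simp
    have bound: "norm ((\<integral>y. apply_bcontfun (gs n) y \<partial>\<sigma>) - (\<integral>y. apply_bcontfun g y \<partial>\<sigma>)) \<le> norm (gs n - g)" for n
    proof -
      have "(\<integral>y. apply_bcontfun (gs n) y \<partial>\<sigma>) - (\<integral>y. apply_bcontfun g y \<partial>\<sigma>)
          = (\<integral>y. apply_bcontfun (gs n - g) y \<partial>\<sigma>)"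
        using integrable_bcontfun[OF \<sigma>] by simp
      also have "norm \<dots> \<le> (\<integral>y. norm (apply_bcontfun (gs n - g) y) \<partial>\<sigma>)"
        by (rule integral_norm_bound)
      also have "\<dots> \<le> (\<integral>y. norm (gs n - g) \<partial>\<sigma>)"
        by (intro integral_mono integrable_norm integrable_bcontfun \<sigma> norm_bounded) auto
      finally show ?thesis by (simp add: prob_space)
    qed
    have norm0: "(\<lambda>n. norm (gs n - g)) \<longlonglongrightarrow> 0"
      by (rule tendsto_norm_zero[OF LIM_zero[OF gs]])
    have "(\<lambda>n. (\<integral>y. apply_bcontfun (gs n) y \<partial>\<sigma>) - (\<integral>y. apply_bcontfun g y \<partial>\<sigma>)) \<longlonglongrightarrow> 0"
      by (rule Lim_null_comparison[OF _ norm0], rule always_eventually, rule allI, rule bound)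
    then have lim: "(\<lambda>n. \<integral>y. apply_bcontfun (gs n) y \<partial>\<sigma>) \<longlonglongrightarrow> (\<integral>y. apply_bcontfun g y \<partial>\<sigma>)"
      by (rule LIM_zero_cancel)
    show "ereal (\<integral>y. apply_bcontfun g y \<partial>\<sigma>) - c (x, signed_of \<sigma>) \<le> liminf (\<lambda>n. T (gs n) x)"
    proof (cases "c (x, signed_of \<sigma>)")
      case (real k)
      have "(\<lambda>n. ereal ((\<integral>y. apply_bcontfun (gs n) y \<partial>\<sigma>) - k)) \<longlonglongrightarrow> ereal ((\<integral>y. apply_bcontfun g y \<partial>\<sigma>) - k)"
        by (intro tendsto_ereal tendsto_diff lim tendsto_const)
      then have "ereal ((\<integral>y. apply_bcontfun g y \<partial>\<sigma>) - k)
          = liminf (\<lambda>n. ereal ((\<integral>y. apply_bcontfun (gs n) y \<partial>\<sigma>) - k))"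
        by (intro lim_imp_Liminf[symmetric]) auto
      also have "\<dots> \<le> liminf (\<lambda>n. T (gs n) x)"
        using upper[OF \<sigma>, of _ x] by (intro Liminf_mono always_eventually) (simp add: real)
      finally show ?thesis by (simp add: real)
    qed (use MInf[OF \<sigma>] in auto)
  qed
  ultimately show ?thesis
    unfolding backward_Kantorovich_operator_def by blast
qed

text \<open>The hypothesis excluding infinity encodes the codomain [-infinity, infinity) inside
  \<open>ereal\<close>. Both equivalences follow from the cycle operator, transfer, cost,
  operator.\<close>

theorem theorem2p2:
  fixes T :: "('b::metric_space \<Rightarrow>\<^sub>C real) \<Rightarrow> 'a::metric_space \<Rightarrow> ereal"
  assumes "compact (UNIV :: 'a set)" and "compact (UNIV :: 'b set)"
    and "\<And>g x. T g x \<noteq> \<infinity>"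
  shows "(backward_Kantorovich_operator T \<longleftrightarrow>
      (\<forall>g. T g \<in> bounded_above_borel) \<and>
      (\<exists>\<T> :: 'a signed_measure \<times> 'b signed_measure \<Rightarrow> ereal.
         backward_linear_transfer \<T> \<and>
         (\<forall>\<mu>\<in>prob_measures. \<forall>g. transfer_conj \<T> \<mu> g = ereal_integral \<mu> (T g))))
    \<and>
    (backward_Kantorovich_operator T \<longleftrightarrow>
      (\<exists>c :: 'a \<times> 'b signed_measure \<Rightarrow> ereal.
         (\<forall>x. \<forall>\<sigma>\<in>signed_of ` prob_measures. c (x, \<sigma>) \<noteq> - \<infinity>) \<and>
         (\<exists>x. \<exists>\<sigma>\<in>signed_of ` prob_measures. c (x, \<sigma>) \<noteq> \<infinity>) \<and>
         lsc_on (UNIV \<times> signed_of ` prob_measures) c \<and>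
         (\<forall>x. \<forall>\<sigma>1\<in>signed_of ` prob_measures. \<forall>\<sigma>2\<in>signed_of ` prob_measures.
            \<forall>t. 0 \<le> t \<and> t \<le> 1 \<longrightarrow>
              c (x, t *\<^sub>R \<sigma>1 + (1 - t) *\<^sub>R \<sigma>2)
                \<le> ereal t * c (x, \<sigma>1) + ereal (1 - t) * c (x, \<sigma>2)) \<and>
         (\<forall>g x. T g x =
            (SUP \<sigma>\<in>prob_measures. ereal (\<integral>y. apply_bcontfun g y \<partial>\<sigma>) - c (x, signed_of \<sigma>)))))"
    (is "(?op \<longleftrightarrow> ?transfer) \<and> (?op \<longleftrightarrow> ?cost)")
proof -
  have 1: ?transfer if op: ?op
  proof (intro conjI allI exI[of _ "lifted_transfer T"] ballI)
    show "T g \<in> bounded_above_borel" for g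
      by (rule operator_bounded_above_borel[OF assms(1,2) op])
    show "backward_linear_transfer (lifted_transfer T)"
      by (rule lifted_transfer_backward_linear_transfer[OF assms(1,2) op])
    show "transfer_conj (lifted_transfer T) \<mu> g = ereal_integral \<mu> (T g)" if "\<mu> \<in> prob_measures" for \<mu> g
      by (rule transfer_conj_lifted_transfer[OF assms(1,2) op that])
  qed
  have 2: ?cost if tr: ?transfer
  proof -
    obtain \<T> where \<T>: "backward_linear_transfer \<T>"
      "\<And>\<mu> g. \<mu> \<in> prob_measures \<Longrightarrow> transfer_conj \<T> \<mu> g = ereal_integral \<mu> (T g)"
      using tr by blast
    show ?thesis by (rule transfer_imp_cost[OF _ \<T>]) (use tr in blast)
  qed
  have 3: ?op if cost: ?cost
  proof -
    from cost obtain c where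
      c: "\<forall>x. \<forall>\<sigma>\<in>signed_of ` prob_measures. c (x, \<sigma>) \<noteq> - \<infinity>"
      "\<exists>x. \<exists>\<sigma>\<in>signed_of ` prob_measures. c (x, \<sigma>) \<noteq> \<infinity>"
      "lsc_on (UNIV \<times> signed_of ` prob_measures) c"
      "\<forall>g x. T g x =
            (SUP \<sigma>\<in>prob_measures. ereal (\<integral>y. apply_bcontfun g y \<partial>\<sigma>) - c (x, signed_of \<sigma>))"
      by blast
    show ?thesis
      by (rule cost_imp_operator[OF assms _ _ c(3)]) (use c in auto)
  qed
  show ?thesis using 1 2 3 by blast
qed

end
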